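(* Let $(\Omega,\mathcal F,P)$ be a probability space and $T:\Omega\to\Omega$ an ergodic measure-preserving map. Let $X$ be a metric space with metric $\rho$ and Borel $\sigma$-algebra $\mathcal X$, let $f:X\times\Omega\to X$ be jointly measurable, and let $\bar x:\Omega\to X$ be a stochastic equilibrium of $f$, i.e. a measurable map with $\bar x(T\omega)=f(\bar x(\omega),\omega)$ almost surely. Let $X(\omega)\subseteq X$ ($\omega\in\Omega$) be a random set such that $\bar x(\omega)\in X(\omega)$ for each $\omega\in\Omega$ and $f(x,\omega)\in X(T\omega)$ for each $\omega\in\Omega$ and $x\in X(\omega)$. For $\delta>0$ put $\bar X(\omega,\delta):=\{x\in X(\omega):\rho(x,\bar x(\omega))\le\delta\}$. Assume that at least one of the following two hypotheses holds. (A) $(X,\rho)$ is a complete separable metric space, and there exist random variables $L(\omega)>0$ and $\delta(\omega)>0$ such that $E|\ln L|<+\infty$, $E|\ln\delta|<+\infty$, $E\ln L<0$, and $$\rho(f(x,\omega),f(\bar x(\omega),\omega))\le L(\omega)\,\rho(x,\bar x(\omega))\quad\text{for all }x\in\bar X(\omega,\delta(\omega)).$$ (B) $X$ is a separable Banach space with norm $\|\cdot\|$ and $\rho(x,y)=\|x-y\|$, and the following two conditions hold: (B1) there exist random variables $L(\omega)>0$ and $\delta(\omega)>0$ such that $E|\ln L|<+\infty$, $E|\ln\delta|<+\infty$, and $\rho(f(x,\omega),f(\bar x(\omega),\omega))\le L(\omega)\,\rho(x,\bar x(\omega))$ for all $x\in\bar X(\omega,\delta(\omega))$; (B2) for each $\omega$,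 the mapping $f(\cdot,\omega):X\to X$ has a Fréchet derivative $f'(\bar x(\omega),\omega)$ at the point $\bar x(\omega)$, and $E\ln\|f'(\bar x(\omega),\omega)\|<0$, where $\|\cdot\|$ is the operator norm. For $a\in X$ let $x_0^a(\omega):=a$ and $x_t^a(\omega):=f(x_{t-1}^a(\omega),T^{t-1}\omega)$ for $t=1,2,\dots$, and let $\bar x_t(\omega):=\bar x(T^t\omega)$ for $t=0,1,2,\dots$. Then there exist a random variable $\gamma(\omega)>0$ and a constant $c<0$ such that, with probability one (i.e. for all $\omega$ in a set of full measure not depending on $a$), $$\limsup_{t\to\infty}\frac1t\ln\rho(x_t^a(\omega),\bar x_t(\omega))\le c\quad\text{for all }a\in\bar X(\omega,\gamma(\omega)).$$
   Context: $E$ denotes expectation with respect to $P$. $T$ measure-preserving means $T$ is $\mathcal F$-measurable and $P(T^{-1}(\Gamma))=P(\Gamma)$ for all $\Gamma\in\mathcal F$ ($T$ need not be invertible); ergodic means every $T$-invariant set has measure $0$ or $1$. A family $X(\omega)\subseteq X$, $\omega\in\Omega$, is a random set if its graph $\{(u,\omega)\in X\times\Omega:u\in X(\omega)\}$ belongs to $\mathcal X\otimes\mathcal F$. Random variables are real-valued. Convention: $\ln 0=-\infty$. The expectation $E\ln\|f'(\bar x(\omega),\omega)\|$ may equal $-\infty$. The Fréchet derivative at $\bar x(\omega)$ is a continuous linear operator $F(\omega)$ on $X$ such that $f(\bar x(\omega)+h,\omega)=f(\bar x(\omega),\omega)+F(\omega)h+g(h,\omega)\|h\|$ for $h\in X$,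 with $g(h,\omega)\to0$ as $\|h\|\to0$; its norm is $\|F\|=\sup\{\|Fh\|/\|h\|:0\ne h\in X\}$. *)

theory Defs
  imports "HOL-Probability.Probability"
begin

locale ergodic_system = prob_space M
  for M :: "'w measure" +
  fixes T :: "'w \<Rightarrow> 'w"
  assumes T_measurable: "T \<in> measurable M M"
    and T_preserving: "\<And>A. A \<in> sets M \<Longrightarrow> prob (T -` A \<inter> space M) = prob A"
    and T_ergodic: "\<And>A. A \<in> sets M \<Longrightarrow> T -` A \<inter> space M = A \<Longrightarrow> prob A = 0 \<or> prob A = 1"

text \<open>Values of \<open>f\<close>, \<open>xbar\<close> and \<open>X\<close> at points outside \<open>space M\<close> are irrelevant
  and left unconstrained throughout.\<close>

locale stochastic_equilibrium = ergodic_system M T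
  for M :: "'w measure" and T :: "'w \<Rightarrow> 'w" +
  fixes f :: "'a::metric_space \<Rightarrow> 'w \<Rightarrow> 'a"
    and xbar :: "'w \<Rightarrow> 'a"
    and X :: "'w \<Rightarrow> 'a set"
  assumes f_measurable: "(\<lambda>(x, w). f x w) \<in> measurable (borel \<Otimes>\<^sub>M M) borel"
    and xbar_measurable: "xbar \<in> measurable M borel"
    and equilibrium: "AE w in M. xbar (T w) = f (xbar w) w"
    and random_set: "{(u, w). w \<in> space M \<and> u \<in> X w} \<in> sets (borel \<Otimes>\<^sub>M M)"
    and xbar_in: "\<And>w. w \<in> space M \<Longrightarrow> xbar w \<in> X w"
    and f_maps: "\<And>w x. w \<in> space M \<Longrightarrow> x \<in> X w \<Longrightarrow> f x w \<in> X (T w)"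

definition near_set :: "('w \<Rightarrow> 'a::metric_space) \<Rightarrow> ('w \<Rightarrow> 'a set) \<Rightarrow> 'w \<Rightarrow> real \<Rightarrow> 'a set" where
  "near_set xbar X w d = {x \<in> X w. dist x (xbar w) \<le> d}"

definition positive_random_variable :: "'w measure \<Rightarrow> ('w \<Rightarrow> real) \<Rightarrow> bool" where
  "positive_random_variable M Y \<longleftrightarrow> Y \<in> borel_measurable M \<and> (\<forall>w\<in>space M. 0 < Y w)"

definition lipschitz_near_equilibrium ::
  "'w measure \<Rightarrow> ('a::metric_space \<Rightarrow> 'w \<Rightarrow> 'a) \<Rightarrow> ('w \<Rightarrow> 'a) \<Rightarrow> ('w \<Rightarrow> 'a set)
    \<Rightarrow> ('w \<Rightarrow> real) \<Rightarrow> ('w \<Rightarrow> real) \<Rightarrow> bool" where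
  "lipschitz_near_equilibrium M f xbar X L \<delta> \<longleftrightarrow>
    positive_random_variable M L \<and> positive_random_variable M \<delta> \<and>
    integrable M (\<lambda>w. ln (L w)) \<and> integrable M (\<lambda>w. ln (\<delta> w)) \<and>
    (\<forall>w\<in>space M. \<forall>x\<in>near_set xbar X w (\<delta> w).
      dist (f x w) (f (xbar w) w) \<le> L w * dist x (xbar w))"

text \<open>The HOL logarithm satisfies \<open>ln 0 = 0\<close>; here the convention is \<open>ln 0 = -\<infinity>\<close>.
  It is only applied to nonnegative arguments.\<close>

definition ext_ln :: "real \<Rightarrow> ereal" where
  "ext_ln x = (if x = 0 then - \<infinity> else ereal (ln x))"

text \<open>Expectation with values in \<open>[-\<infinity>, \<infinity>]\<close>: expectation of the positive part minus expectation
  of the negative part (\<open>e2ennreal\<close> sends negative numbers to \<open>0\<close>).  In type \<open>ereal\<close> one has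
  \<open>\<infinity> - \<infinity> = \<infinity>\<close>, so a negative value entails that the expectation of the positive part is
  finite, i.e. that the expectation exists.\<close>

definition ext_expectation :: "'w measure \<Rightarrow> ('w \<Rightarrow> ereal) \<Rightarrow> ereal" where
  "ext_expectation M Y =
    enn2ereal (\<integral>\<^sup>+ w. e2ennreal (Y w) \<partial>M) - enn2ereal (\<integral>\<^sup>+ w. e2ennreal (- Y w) \<partial>M)"

primrec trajectory :: "('w \<Rightarrow> 'w) \<Rightarrow> ('a \<Rightarrow> 'w \<Rightarrow> 'a) \<Rightarrow> 'a \<Rightarrow> 'w \<Rightarrow> nat \<Rightarrow> 'a" where
  "trajectory T f a w 0 = a"
| "trajectory T f a w (Suc t) = f (trajectory T f a w t) ((T ^^ t) w)"

text \<open>The term of the sequence for \<open>t = 0\<close> has a meaningless factor \<open>1 / 0 = 0\<close>, which does not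
  affect the upper limit.\<close>

definition locally_exponentially_stable ::
  "'w measure \<Rightarrow> ('w \<Rightarrow> 'w) \<Rightarrow> ('a::metric_space \<Rightarrow> 'w \<Rightarrow> 'a) \<Rightarrow> ('w \<Rightarrow> 'a) \<Rightarrow> ('w \<Rightarrow> 'a set) \<Rightarrow> bool"
  where
  "locally_exponentially_stable M T f xbar X \<longleftrightarrow>
    (\<exists>(\<gamma> :: 'w \<Rightarrow> real) (c :: real).
      positive_random_variable M \<gamma> \<and> c < 0 \<and>
      (AE w in M. \<forall>a\<in>near_set xbar X w (\<gamma> w).
        limsup (\<lambda>t. ereal (1 / real t) * ext_ln (dist (trajectory T f a w t) (xbar ((T ^^ t) w))))
          \<le> ereal c))"

end

(* By the maximal ergodic argument, sum_{i<n} ln L(T^i w) <= K(w) - 2 l n for some l > 0, while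
   integrability of ln delta makes delta(T^n w) decay at most like exp(-l n). Hence the random
   radius gamma(w) = inf_n min(1, delta(T^n w) exp(-sum_{i<n} ln L(T^i w))) is positive almost
   surely, and a trajectory started within it never leaves the region where the Lipschitz bound
   applies; this gives (A).

   For (B), choose a random variable kappa strictly above the norm of the derivative with
   E ln kappa < 0. Each w has a radius below which f(.,w) contracts by kappa(w), but nothing
   makes that radius measurable. The set of w for which the radius 1/n is not small enough is
   the projection of a measurable subset of X * Omega, so by the measurable projection theorem
   (via the Souslin operation and Choquet's capacity argument) its measure tends to 0. On a
   measurable hull of it keep the constant L, elsewhere use kappa; for large n the expected
   logarithm of the new constant is still negative, and (A) applies with the radius
   min(delta, 1/n). *)

theory Submission
  imports Defs "HOL-Real_Asymp.Real_Asymp"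
begin

section \<open>Souslin sets and the measurable projection theorem\<close>

text \<open>This is continuity from the Baire space to a discrete space; the number \<open>k\<close>
  of deciding coordinates may vary with \<sigma>.\<close>

definition locally_constant :: "((nat \<Rightarrow> nat) \<Rightarrow> 'c) \<Rightarrow> bool" where
  "locally_constant h \<longleftrightarrow> (\<forall>\<sigma>. \<exists>k. \<forall>\<tau>. (\<forall>i<k. \<tau> i = \<sigma> i) \<longrightarrow> h \<tau> = h \<sigma>)"

text \<open>The usual Souslin operation, with families indexed by finite sequences replaced by locally
  constant functions on the Baire space: then countable unions and intersections are formed
  without bookkeeping of lengths.\<close>

definition souslin :: "'c set set \<Rightarrow> 'c set set" where
  "souslin R = {(\<Union>\<sigma>. \<Inter>n. E n \<sigma>) |E. \<forall>n::nat. locally_constant (E n) \<and> (\<forall>\<sigma>. E n \<sigma> \<in> R)}"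

lemma souslinI:
  assumes "\<And>n::nat. locally_constant (E n)" "\<And>n \<sigma>. E n \<sigma> \<in> R" "A = (\<Union>\<sigma>. \<Inter>n. E n \<sigma>)"
  shows "A \<in> souslin R"
  using assms by (auto simp: souslin_def)

lemma souslinE:
  assumes "A \<in> souslin R"
  obtains E :: "nat \<Rightarrow> (nat \<Rightarrow> nat) \<Rightarrow> 'c set"
  where "\<forall>n. locally_constant (E n)" "\<forall>n \<sigma>. E n \<sigma> \<in> R" "A = (\<Union>\<sigma>. \<Inter>n. E n \<sigma>)"
proof -
  obtain E :: "nat \<Rightarrow> (nat \<Rightarrow> nat) \<Rightarrow> 'c set"
    where "A = (\<Union>\<sigma>. \<Inter>n. E n \<sigma>) \<and> (\<forall>n. locally_constant (E n) \<and> (\<forall>\<sigma>. E n \<sigma> \<in> R))"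
    using assms unfolding souslin_def mem_Collect_eq ..
  then show ?thesis by (intro that[of E]) simp_all
qed

section \<open>Stability of local constancy under composition, reindexing and pairing\<close>

lemma locally_constant_compose: "locally_constant h \<Longrightarrow> locally_constant (\<lambda>\<sigma>. g (h \<sigma>))"
proof -
  assume h: "locally_constant h"
  show ?thesis
    unfolding locally_constant_def
  proof
    fix \<sigma>
    obtain k where k: "\<forall>\<tau>. (\<forall>i<k. \<tau> i = \<sigma> i) \<longrightarrow> h \<tau> = h \<sigma>"
      using h unfolding locally_constant_def by blast
    show "\<exists>k. \<forall>\<tau>. (\<forall>i<k. \<tau> i = \<sigma> i) \<longrightarrow> g (h \<tau>) = g (h \<sigma>)"
      by (intro exI[of _ k] allI impI arg_cong[of _ _ g]) (rule k[rule_format], blast)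
  qed
qed

lemma locally_constant_const [simp]: "locally_constant (\<lambda>\<sigma>. c)"
  by (simp add: locally_constant_def)

lemma locally_constant_nth: "locally_constant (\<lambda>\<sigma>. \<sigma> i)"
  unfolding locally_constant_def by (intro allI exI[of _ "Suc i"]) simp

lemma locally_constant_reindex:
  assumes "locally_constant h"
  shows "locally_constant (\<lambda>\<sigma>. h (\<lambda>m. \<sigma> (p m)))"
  unfolding locally_constant_def
proof
  fix \<sigma> :: "nat \<Rightarrow> nat"
  obtain k where k: "\<And>\<tau>. (\<forall>i<k. \<tau> i = \<sigma> (p i)) \<Longrightarrow> h \<tau> = h (\<lambda>m. \<sigma> (p m))"
    using assms unfolding locally_constant_def by meson
  \<comment> \<open>For \<open>k = 0\<close> the \<open>Max\<close> of the empty set is unspecified,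
    which is harmless because there is then no \<open>i < k\<close> to check.\<close>
  have "h (\<lambda>m. \<tau> (p m)) = h (\<lambda>m. \<sigma> (p m))" if "\<forall>j<Suc (Max (p ` {..<k})). \<tau> j = \<sigma> j" for \<tau>
  proof (rule k, safe)
    fix i assume "i < k"
    then have "p i \<le> Max (p ` {..<k})" by auto
    with that show "\<tau> (p i) = \<sigma> (p i)" by auto
  qed
  then show "\<exists>k. \<forall>\<tau>. (\<forall>i<k. \<tau> i = \<sigma> i) \<longrightarrow> h (\<lambda>m. \<tau> (p m)) = h (\<lambda>m. \<sigma> (p m))" by blast
qed

lemma locally_constant_Pair:
  assumes "locally_constant g" "locally_constant h"
  shows "locally_constant (\<lambda>\<sigma>. (g \<sigma>, h \<sigma>))"
  unfolding locally_constant_def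
proof
  fix \<sigma> :: "nat \<Rightarrow> nat"
  obtain k l where kl: "\<And>\<tau>. (\<forall>i<k. \<tau> i = \<sigma> i) \<Longrightarrow> g \<tau> = g \<sigma>"
      "\<And>\<tau>. (\<forall>i<l. \<tau> i = \<sigma> i) \<Longrightarrow> h \<tau> = h \<sigma>"
    using assms unfolding locally_constant_def by meson
  have "(g \<tau>, h \<tau>) = (g \<sigma>, h \<sigma>)" if "\<forall>i<max k l. \<tau> i = \<sigma> i" for \<tau>
    using kl(1)[of \<tau>] kl(2)[of \<tau>] that by simp
  then show "\<exists>k. \<forall>\<tau>. (\<forall>i<k. \<tau> i = \<sigma> i) \<longrightarrow> (g \<tau>, h \<tau>) = (g \<sigma>, h \<sigma>)"
    by blast
qed

lemma locally_constant_initial: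
  assumes "\<And>i. locally_constant (g i)"
  shows "locally_constant (\<lambda>\<sigma>. map (\<lambda>i. g i \<sigma>) [0..<n])"
proof (induction n)
  case (Suc n)
  from locally_constant_compose[OF locally_constant_Pair[OF Suc assms[of n]], of "\<lambda>(x, y). x @ [y]"]
  show ?case by simp
qed simp

lemma locally_constant_case:
  assumes "\<And>j. locally_constant (g j)"
  shows "locally_constant (\<lambda>\<sigma>. g (\<sigma> 0) (\<lambda>m. \<sigma> (Suc m)))"
  unfolding locally_constant_def
proof
  fix \<sigma> :: "nat \<Rightarrow> nat"
  obtain k where k: "\<And>\<tau>. (\<forall>i<k. \<tau> i = \<sigma> i) \<Longrightarrow>
      g (\<sigma> 0) (\<lambda>m. \<tau> (Suc m)) = g (\<sigma> 0) (\<lambda>m. \<sigma> (Suc m))"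
    using locally_constant_reindex[OF assms, of "\<sigma> 0" Suc] unfolding locally_constant_def by meson
  have "g (\<tau> 0) (\<lambda>m. \<tau> (Suc m)) = g (\<sigma> 0) (\<lambda>m. \<sigma> (Suc m))" if "\<forall>i<Suc k. \<tau> i = \<sigma> i" for \<tau>
    using k[of \<tau>] that by simp
  then show "\<exists>k. \<forall>\<tau>. (\<forall>i<k. \<tau> i = \<sigma> i) \<longrightarrow>
      g (\<tau> 0) (\<lambda>m. \<tau> (Suc m)) = g (\<sigma> 0) (\<lambda>m. \<sigma> (Suc m))" by blast
qed

section \<open>Countable operations on Souslin sets\<close>

lemma souslin_basic: "A \<in> R \<Longrightarrow> A \<in> souslin R"
  by (rule souslinI[of "\<lambda>n \<sigma>. A"]) auto

text \<open>The first coordinate of the new index names a member of the union, and the shifted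
  sequence serves as the index for that member.\<close>

lemma souslin_UN:
  assumes "\<And>i::nat. A i \<in> souslin R"
  shows "(\<Union>i. A i) \<in> souslin R"
proof -
  have "\<exists>E. (\<forall>n::nat. locally_constant (E n)) \<and> (\<forall>n \<sigma>. E n \<sigma> \<in> R) \<and> A i = (\<Union>\<sigma>. \<Inter>n. E n \<sigma>)" for i
    using assms[of i] by (rule souslinE) blast
  then obtain E where E: "\<And>i n::nat. locally_constant (E i n)" "\<And>i n \<sigma>. E i n \<sigma> \<in> R"
      "\<And>i. A i = (\<Union>\<sigma>. \<Inter>n. E i n \<sigma>)"
    by metis
  show ?thesis
  proof (rule souslinI[where E = "\<lambda>n \<sigma>. E (\<sigma> 0) n (\<lambda>m. \<sigma> (Suc m))"])
    show "locally_constant (\<lambda>\<sigma>. E (\<sigma> 0) n (\<lambda>m. \<sigma> (Suc m)))" for n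
      using locally_constant_case[of "\<lambda>j. E j n"] E(1) by simp
    show "(\<Union>i. A i) = (\<Union>\<sigma>. \<Inter>n. E (\<sigma> 0) n (\<lambda>m. \<sigma> (Suc m)))"
    proof (intro equalityI subsetI)
      fix x assume "x \<in> (\<Union>i. A i)"
      then obtain i \<sigma> where "\<And>n. x \<in> E i n \<sigma>" by (auto simp: E(3))
      then show "x \<in> (\<Union>\<sigma>. \<Inter>n. E (\<sigma> 0) n (\<lambda>m. \<sigma> (Suc m)))"
        by (intro UN_I[where a = "case_nat i \<sigma>"]) auto
    qed (auto simp: E(3))
  qed (use E in auto)
qed

text \<open>One sequence codes countably many: its coordinates at \<open>prod_encode (i, m)\<close>
  form the index for the \<open>i\<close>-th set. The pairs \<open>(i, n)\<close> of conditions are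
  enumerated in the same way.\<close>

lemma souslin_INT:
  assumes "\<And>i::nat. A i \<in> souslin R"
  shows "(\<Inter>i. A i) \<in> souslin R"
proof -
  have "\<exists>E. (\<forall>n::nat. locally_constant (E n)) \<and> (\<forall>n \<sigma>. E n \<sigma> \<in> R) \<and> A i = (\<Union>\<sigma>. \<Inter>n. E n \<sigma>)" for i
    using assms[of i] by (rule souslinE) blast
  then obtain E where E: "\<And>i n::nat. locally_constant (E i n)" "\<And>i n \<sigma>. E i n \<sigma> \<in> R"
      "\<And>i. A i = (\<Union>\<sigma>. \<Inter>n. E i n \<sigma>)"
    by metis
  define G where "G n \<sigma> = E (fst (prod_decode n)) (snd (prod_decode n))
    (\<lambda>m. \<sigma> (prod_encode (fst (prod_decode n), m)))" for n \<sigma>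
  show ?thesis
  proof (rule souslinI[where E = G])
    show "locally_constant (G n)" for n
      unfolding G_def
      using locally_constant_reindex[OF E(1), where p = "\<lambda>m. prod_encode (fst (prod_decode n), m)"]
      by simp
    show "(\<Inter>i. A i) = (\<Union>\<sigma>. \<Inter>n. G n \<sigma>)"
    proof (intro equalityI subsetI)
      fix x assume "x \<in> (\<Inter>i. A i)"
      then have "\<forall>i. \<exists>\<sigma>. \<forall>n. x \<in> E i n \<sigma>" by (auto simp: E(3))
      then obtain \<sigma> where "\<And>i n. x \<in> E i n (\<sigma> i)" by metis
      then show "x \<in> (\<Union>\<sigma>. \<Inter>n. G n \<sigma>)"
        by (intro UN_I[where a = "\<lambda>j. \<sigma> (fst (prod_decode j)) (snd (prod_decode j))"])
           (auto simp: G_def)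
    next
      fix x assume "x \<in> (\<Union>\<sigma>. \<Inter>n. G n \<sigma>)"
      then obtain \<sigma> where *: "\<And>n. x \<in> G n \<sigma>" by auto
      have "x \<in> E i n (\<lambda>m. \<sigma> (prod_encode (i, m)))" for i n
        using *[of "prod_encode (i, n)"] by (simp add: G_def)
      then show "x \<in> (\<Inter>i. A i)" by (auto simp: E(3))
    qed
  qed (use E in \<open>auto simp: G_def\<close>)
qed

lemma souslin_Un: "A \<in> souslin R \<Longrightarrow> B \<in> souslin R \<Longrightarrow> A \<union> B \<in> souslin R"
proof -
  assume "A \<in> souslin R" "B \<in> souslin R"
  then have "(\<Union>i::nat. if i = 0 then A else B) \<in> souslin R"
    by (intro souslin_UN) auto
  also have "(\<Union>i::nat. if i = 0 then A else B) = A \<union> B"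
    by (auto split: if_splits intro: exI[of _ 1])
  finally show ?thesis .
qed

text \<open>Souslin sets are in general not closed under complement. The induction therefore runs
  over sets that are Souslin together with their complement; closure under unions uses both
  \<open>souslin_UN\<close> and \<open>souslin_INT\<close>.\<close>

lemma sigma_sets_subset_souslin:
  assumes R: "R \<subseteq> Pow S" "{} \<in> R" "S \<in> R" and compl: "\<And>A. A \<in> R \<Longrightarrow> S - A \<in> souslin R"
  shows "sigma_sets S R \<subseteq> souslin R"
proof -
  have "A \<in> souslin R \<and> S - A \<in> souslin R" if "A \<in> sigma_sets S R" for A
    using that
  proof induction
    case (Compl A)
    moreover have "A \<subseteq> S" using Compl R(1) sigma_sets_into_sp by metis
    ultimately show ?case by (simp add: double_diff)
  next
    case (Union A)
    then have "(\<Inter>i. S - A i) \<in> souslin R" by (intro souslin_INT) auto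
    moreover have "(\<Inter>i. S - A i) = S - (\<Union>i. A i)" by auto
    ultimately show ?case using Union by (auto intro: souslin_UN)
  qed (use R compl in \<open>auto intro: souslin_basic\<close>)
  then show ?thesis by blast
qed

section \<open>Souslin sets in a product and their projections\<close>

text \<open>The first side is taken closed so that limits stay inside it when it is projected away.
  Complements of such rectangles remain Souslin because open sets in a metric space are countable
  unions of closed sets.\<close>

lemma souslin_pair_measure:
  "sets ((borel :: 'a::metric_space measure) \<Otimes>\<^sub>M M) \<subseteq>
    souslin {F \<times> G |F G. closed F \<and> G \<in> sets M}" (is "_ \<subseteq> souslin ?R")
proof -
  have "sets ((borel :: 'a measure) \<Otimes>\<^sub>M M) =
      sets (sigma UNIV (Collect closed) \<Otimes>\<^sub>M sigma (space M) (sets M))"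
    by (intro sets_pair_measure_cong) (auto simp: borel_eq_closed)
  also have "\<dots> = sets (sigma (UNIV \<times> space M) ?R)"
    by (subst sigma_prod) (auto simp: sets.space_closed intro!: exI[of _ "{UNIV}"] exI[of _ "{space M}"])
  also have "\<dots> = sigma_sets (UNIV \<times> space M) ?R"
    by (intro sets_measure_of) (use sets.sets_into_space in auto)
  also have "\<dots> \<subseteq> souslin ?R"
  proof (rule sigma_sets_subset_souslin)
    show "?R \<subseteq> Pow (UNIV \<times> space M)" using sets.sets_into_space by auto
    show "{} \<in> ?R" by (auto intro!: exI[of _ "{}"])
    show "UNIV \<times> space M \<in> ?R" by auto
    fix A assume "A \<in> ?R"
    then obtain F G where A: "A = F \<times> G" "closed F" "G \<in> sets M" by auto
    have "fsigma_in euclidean (- F)"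
      using A(2) by (intro open_imp_fsigma_in metrizable_space_euclidean) (auto simp: open_Compl)
    then obtain C where C: "\<And>n::nat. closed (C n)" "- F = (\<Union>n. C n)"
      unfolding fsigma_in_ascending closed_closedin[symmetric] by metis
    have eq: "UNIV \<times> space M - A = (\<Union>n. C n \<times> space M) \<union> UNIV \<times> (space M - G)"
    proof -
      have "(\<Union>n. C n \<times> space M) = (- F) \<times> space M"
        by (simp only: C(2)) blast
      then show ?thesis unfolding A(1) by blast
    qed
    show "UNIV \<times> space M - A \<in> souslin ?R"
      unfolding eq
    proof (rule souslin_Un)
      show "(\<Union>n. C n \<times> space M) \<in> souslin ?R"
        by (intro souslin_UN souslin_basic) (use C in auto)
      show "UNIV \<times> (space M - G) \<in> souslin ?R"
        using A by (intro souslin_basic) auto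
    qed
  qed
  finally show ?thesis .
qed

text \<open>The forgotten point can be coded by a sequence of approximations from a countable dense
  set, and quantifying over such codes is absorbed by the Souslin operation. Completeness and
  closedness recover the point from its code.\<close>

lemma souslin_projection:
  fixes A :: "('a::{complete_space, second_countable_topology} \<times> 'b) set"
  assumes A: "A \<in> souslin {F \<times> G |F G. closed F \<and> G \<in> sets M}"
  shows "snd ` A \<in> souslin (sets M)"
proof -
  define R where "R = {F \<times> G |(F :: 'a set) G. closed F \<and> G \<in> sets M}"
  have "A \<in> souslin R" using A unfolding R_def .
  then obtain E :: "nat \<Rightarrow> (nat \<Rightarrow> nat) \<Rightarrow> ('a \<times> 'b) set"
    where "\<forall>n. locally_constant (E n)" "\<forall>n \<sigma>. E n \<sigma> \<in> R" "A = (\<Union>\<sigma>. \<Inter>n. E n \<sigma>)"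
    by (rule souslinE)
  note E = this[rule_format]
  \<comment> \<open>The sides are chosen as functions of the set \<open>B\<close>, not of its index,
    so that composing them with \<open>E n\<close> preserves local constancy.\<close>
  have "\<forall>B. B \<in> R \<longrightarrow> (\<exists>p. B = fst p \<times> snd p \<and> closed (fst p) \<and> snd p \<in> sets M)"
    by (auto simp: R_def)
  then obtain p where p: "B \<in> R \<longrightarrow> B = fst (p B) \<times> snd (p B) \<and> closed (fst (p B)) \<and> snd (p B) \<in> sets M" for B
    by (simp only: choice_iff') blast
  define F where "F B = fst (p B)" for B
  define G where "G B = snd (p B)" for B
  have "E n \<sigma> = F (E n \<sigma>) \<times> G (E n \<sigma>) \<and> closed (F (E n \<sigma>)) \<and> G (E n \<sigma>) \<in> sets M" for n \<sigma>
    unfolding F_def G_def using p[of "E n \<sigma>"] E(2) by (rule mp)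
  note FG = this[THEN conjunct1] this[THEN conjunct2, THEN conjunct1] this[THEN conjunct2, THEN conjunct2]
  obtain D :: "'a set" where D: "countable D" "\<And>X. open X \<Longrightarrow> X \<noteq> {} \<Longrightarrow> \<exists>d\<in>D. d \<in> X"
    by (rule countable_dense_setE) blast
  have "D \<noteq> {}" using D(2)[of UNIV] by auto
  define d where "d = from_nat_into D"
  have d: "\<exists>j. dist x (d j) \<le> e" if "e > 0" for x e
  proof -
    obtain y where y: "y \<in> D" "dist x y < e" using D(2)[OF open_ball, of x e] \<open>e > 0\<close> by force
    obtain j where "d j = y"
      using from_nat_into_surj[OF D(1) y(1)] by (auto simp: d_def)
    then show ?thesis using y(2) by (intro exI[of _ j]) simp
  qed
  \<comment> \<open>The even coordinates are the old index; the odd ones choose centres of small balls closing in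
    on the point that the projection forgets.\<close>
  define pt where "pt n \<sigma> x \<longleftrightarrow> (\<forall>i<Suc n. x \<in> F (E i (\<lambda>m. \<sigma> (2 * m))) \<and>
      dist x (d (\<sigma> (2 * i + 1))) \<le> (1/2) ^ i)" for n \<sigma> x
  \<comment> \<open>The test for a common point does not involve the second component, so each
    \<open>H n \<sigma>\<close> is either a whole measurable side or empty.\<close>
  define H where "H n \<sigma> = (if \<exists>x. pt n \<sigma> x then G (E n (\<lambda>m. \<sigma> (2 * m))) else {})" for n \<sigma>
  show ?thesis
  proof (rule souslinI[where E = H])
    fix n
    have 1: "locally_constant (\<lambda>\<sigma>. map (\<lambda>i. (E i (\<lambda>m. \<sigma> (2 * m)), \<sigma> (2 * i + 1))) [0..<Suc n])"
      by (rule locally_constant_initial, rule locally_constant_Pair[OF _ locally_constant_nth],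
          rule locally_constant_reindex[OF E(1)])
    have 2: "locally_constant (\<lambda>\<sigma>. E n (\<lambda>m. \<sigma> (2 * m)))"
      by (rule locally_constant_reindex[OF E(1)])
    \<comment> \<open>\<open>H n\<close> depends only on finitely many locally constant data, namely
      a list and a set; \<open>\<Phi>\<close> is that dependence.\<close>
    define \<Phi> where "\<Phi> = (\<lambda>(l, B). if \<exists>x. \<forall>i<Suc n. x \<in> F (fst (l ! i)) \<and>
        dist x (d (snd (l ! i))) \<le> (1/2) ^ i then G B else {})"
    have "H n = (\<lambda>\<sigma>. \<Phi> (map (\<lambda>i. (E i (\<lambda>m. \<sigma> (2 * m)), \<sigma> (2 * i + 1))) [0..<Suc n],
        E n (\<lambda>m. \<sigma> (2 * m))))"
      unfolding H_def pt_def \<Phi>_def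
      by (intro ext) (simp del: upt_Suc cong: conj_cong imp_cong)
    then show "locally_constant (H n)"
      using locally_constant_compose[OF locally_constant_Pair[OF 1 2], of \<Phi>] by (simp only:)
  next
    show "snd ` A = (\<Union>\<sigma>. \<Inter>n. H n \<sigma>)"
    proof (intro equalityI subsetI)
      fix w assume "w \<in> snd ` A"
      then obtain x \<sigma> where x: "\<forall>n. (x, w) \<in> E n \<sigma>" unfolding E(3) by fastforce
      have "\<exists>j. dist x (d j) \<le> (1/2) ^ i" for i :: nat by (rule d) simp
      then obtain \<tau> where \<tau>: "\<And>i. dist x (d (\<tau> i)) \<le> (1/2) ^ i" by metis
      have xF: "x \<in> F (E n \<sigma>)" "w \<in> G (E n \<sigma>)" for n
        using spec[OF x, of n] FG(1)[of n \<sigma>] by auto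
      have "w \<in> H n (\<lambda>m. if even m then \<sigma> (m div 2) else \<tau> (m div 2))" for n
        using xF \<tau> by (auto simp: H_def pt_def intro!: exI[of _ x])
      then show "w \<in> (\<Union>\<sigma>. \<Inter>n. H n \<sigma>)" by blast
    next
      fix w assume "w \<in> (\<Union>\<sigma>. \<Inter>n. H n \<sigma>)"
      then obtain \<sigma> where w: "\<And>n. w \<in> H n \<sigma>" by auto
      define \<rho> where "\<rho> = (\<lambda>m. \<sigma> (2 * m))"
      have wG: "\<exists>x. pt n \<sigma> x" "w \<in> G (E n \<rho>)" for n
        using w[of n] by (auto simp: H_def \<rho>_def split: if_splits)
      then obtain x where x: "\<And>n. pt n \<sigma> (x n)" by metis
      have xd: "dist (x n) (d (\<sigma> (2 * i + 1))) \<le> (1/2) ^ i" and xF: "x n \<in> F (E i \<rho>)" if "i \<le> n" for i n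
        using x[of n] that by (auto simp: pt_def \<rho>_def)
      have "Cauchy x"
      proof (rule metric_CauchyI)
        fix e :: real assume "e > 0"
        then obtain N :: nat where N: "(1/2) ^ N < e / 2"
          using real_arch_pow_inv[of "e/2" "1/2"] by auto
        have "dist (x m) (x n) < e" if "m \<ge> N" "n \<ge> N" for m n
          using xd[OF that(1)] xd[OF that(2)] N dist_triangle2[of "x m" "x n" "d (\<sigma> (2 * N + 1))"]
          by linarith
        then show "\<exists>M. \<forall>m\<ge>M. \<forall>n\<ge>M. dist (x m) (x n) < e" by blast
      qed
      then obtain y where y: "x \<longlonglongrightarrow> y" by (auto simp: Cauchy_convergent_iff convergent_def)
      have "y \<in> F (E i \<rho>)" for i
        by (rule Lim_in_closed_set[OF FG(2) _ _ y]) (auto simp: eventually_sequentially intro!: exI[of _ i] xF)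
      then have "(y, w) \<in> E i \<rho>" for i using wG(2)[of i] FG(1)[of i \<rho>] by auto
      then have "(y, w) \<in> A" by (auto simp: E(3))
      then show "w \<in> snd ` A" by force
    qed
  qed (simp add: H_def FG(3))
qed

section \<open>Compactness, capacitability and measurability in the completion\<close>

text \<open>A form of Koenig's lemma: a product of finite sets is compact, and convergence in a
  discrete coordinate means being eventually constant.\<close>

lemma bounded_sequences_cluster:
  fixes \<sigma> :: "nat \<Rightarrow> nat \<Rightarrow> nat"
  assumes "\<And>k i. i < k \<Longrightarrow> \<sigma> k i \<le> \<eta> i"
  obtains l where "\<And>k. \<exists>m\<ge>k. \<forall>i<k. \<sigma> m i = l i"
proof -
  \<comment> \<open>Nothing bounds \<open>\<sigma> k\<close> from position \<open>k\<close> on;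
    zeros there put the sequence into the compact box. Requiring \<open>m \<ge> k\<close> at the end
    undoes this change on the first \<open>k\<close> coordinates.\<close>
  define \<tau> where "\<tau> k = (\<lambda>i. if i < k then \<sigma> k i else 0)" for k
  have "compactin (product_topology (\<lambda>i. euclidean) UNIV) (PiE UNIV (\<lambda>i. {..\<eta> i}))"
    by (subst compactin_PiE) (auto simp: finite_imp_compact)
  then have "compact (PiE UNIV (\<lambda>i. {..\<eta> i}))"
    by (simp add: euclidean_product_topology)
  then have "seq_compact (PiE UNIV (\<lambda>i. {..\<eta> i}))"
    by (rule compact_imp_seq_compact)
  moreover have "\<tau> k \<in> PiE UNIV (\<lambda>i. {..\<eta> i})" for k
    using assms by (auto simp: \<tau>_def)
  ultimately obtain l r where r: "strict_mono (r :: nat \<Rightarrow> nat)" "(\<tau> \<circ> r) \<longlonglongrightarrow> l"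
    by (metis seq_compactE)
  have "\<forall>\<^sub>F j in sequentially. \<tau> (r j) i = l i" for i
    using continuous_on_tendsto_compose[OF continuous_on_product_coordinates[of i] r(2)]
    by (simp add: tendsto_discrete)
  then have "\<forall>\<^sub>F j in sequentially. \<forall>i\<in>{..<k}. \<tau> (r j) i = l i" for k
    by (intro eventually_ball_finite) auto
  then have ev: "\<forall>\<^sub>F j in sequentially. (\<forall>i\<in>{..<k}. \<tau> (r j) i = l i) \<and> j \<ge> k" for k
    using eventually_ge_at_top eventually_conj by blast
  have "\<exists>m\<ge>k. \<forall>i<k. \<sigma> m i = l i" for k
  proof -
    obtain j where j: "\<forall>i<k. \<tau> (r j) i = l i" "j \<ge> k"
      using eventually_happens'[OF _ ev[of k]] by auto
    have "r j \<ge> k" using j(2) seq_suble[OF r(1), of j] by linarith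
    then show ?thesis using j(1) by (intro exI[of _ "r j"]) (auto simp: \<tau>_def)
  qed
  then show ?thesis using that by blast
qed

text \<open>Choquet's argument: bounding the coordinates of \<open>\<sigma>\<close> one after the other by \<open>\<eta>\<close> keeps the outer
  measure above \<open>c\<close>, and the sequences bounded by \<open>\<eta>\<close> form a compact set.\<close>

lemma (in finite_measure) souslin_inner_approx:
  assumes A: "A \<in> souslin (sets M)" and c: "c < outer_measure_of M A"
  shows "\<exists>K\<in>sets M. K \<subseteq> A \<and> c \<le> emeasure M K"
proof -
  obtain E :: "nat \<Rightarrow> (nat \<Rightarrow> nat) \<Rightarrow> 'a set" where "\<forall>n. locally_constant (E n)"
    "\<forall>n \<sigma>. E n \<sigma> \<in> sets M" "A = (\<Union>\<sigma>. \<Inter>n. E n \<sigma>)"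
    using A by (rule souslinE)
  note E = this[rule_format]
  define S where "S k \<eta> = {w. \<exists>\<sigma>. (\<forall>i<k. \<sigma> i \<le> \<eta> i) \<and> (\<forall>n. w \<in> E n \<sigma>)}"
    for k and \<eta> :: "nat \<Rightarrow> nat"
  have S0: "S 0 \<eta> = A" for \<eta> by (auto simp: S_def E(3))
  have step: "\<exists>m. c < outer_measure_of M (S (Suc k) (\<eta>(k := m)))" if "c < outer_measure_of M (S k \<eta>)" for k \<eta>
  proof -
    have "(\<Union>m. S (Suc k) (\<eta>(k := m))) = S k \<eta>"
      unfolding S_def by (auto simp: less_Suc_eq all_conj_distrib)
    \<comment> \<open>Outer measure is continuous along increasing sequences of arbitrary subsets of
      the space, so no measurability of these sets has to be known.\<close>
    moreover have "(SUP m. outer_measure_of M (S (Suc k) (\<eta>(k := m)))) =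
        outer_measure_of M (\<Union>m. S (Suc k) (\<eta>(k := m)))"
    proof (rule SUP_outer_measure_of_incseq)
      show "S (Suc k) (\<eta>(k := m)) \<subseteq> space M" for m
        using E(2) sets.sets_into_space by (fastforce simp: S_def)
      show "incseq (\<lambda>m. S (Suc k) (\<eta>(k := m)))"
      proof (rule incseq_SucI)
        fix m
        have "j \<le> (\<eta>(k := Suc m)) i" if "j \<le> (\<eta>(k := m)) i" for i j
          using that by (auto split: if_splits)
        then show "S (Suc k) (\<eta>(k := m)) \<subseteq> S (Suc k) (\<eta>(k := Suc m))"
          unfolding S_def by blast
      qed
    qed
    ultimately show ?thesis using that by (metis less_SUP_iff)
  qed
  have "\<exists>h. \<forall>k. c < outer_measure_of M (S k (h k)) \<and> (\<exists>m. h (Suc k) = (h k)(k := m))"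
  proof (rule dependent_nat_choice)
    show "\<exists>x. c < outer_measure_of M (S 0 x)" using c S0 by simp
    fix x k assume "c < outer_measure_of M (S k x)"
    then show "\<exists>y. c < outer_measure_of M (S (Suc k) y) \<and> (\<exists>m. y = x(k := m))"
      using step by blast
  qed
  then obtain h where h: "\<And>k. c < outer_measure_of M (S k (h k))" "\<And>k. \<exists>m. h (Suc k) = (h k)(k := m)"
    by metis
  \<comment> \<open>Passing from \<open>h k\<close> to \<open>h (Suc k)\<close> changes only
    coordinate \<open>k\<close>, so coordinate \<open>i\<close> has its final value from
    \<open>h (Suc i)\<close> on.\<close>
  define \<eta> where "\<eta> i = h (Suc i) i" for i
  have "h k i = \<eta> i" if "i < k" for k i
    using that
  proof (induction k)
    case (Suc k)
    then show ?case using h(2)[of k] by (cases "i = k") (auto simp: \<eta>_def)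
  qed simp
  then have "S k (h k) = S k \<eta>" for k
    by (simp add: S_def)
  then have S\<eta>: "c < outer_measure_of M (S k \<eta>)" for k using h(1) by metis
  \<comment> \<open>\<open>H k \<sigma>\<close> is the part of the intersection already decided by the first \<open>k\<close> coordinates of \<open>\<sigma>\<close>.\<close>
  define D where "D k \<sigma> = {n. n < k \<and> (\<forall>\<tau>. (\<forall>i<k. \<tau> i = \<sigma> i) \<longrightarrow> E n \<tau> = E n \<sigma>)}" for k \<sigma>
  define H where "H k \<sigma> = space M \<inter> (\<Inter>n\<in>D k \<sigma>. E n \<sigma>)" for k \<sigma>
  have D_mono: "D k \<sigma> \<subseteq> D m \<sigma>" if "k \<le> m" for k m \<sigma>
  proof
    fix n assume n: "n \<in> D k \<sigma>"
    have "E n \<tau> = E n \<sigma>" if "\<forall>i<m. \<tau> i = \<sigma> i" for \<tau>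
    proof -
      have "\<forall>i<k. \<tau> i = \<sigma> i" using that \<open>k \<le> m\<close> by (meson less_le_trans)
      then show ?thesis using n unfolding D_def by blast
    qed
    moreover have "n < m" using n \<open>k \<le> m\<close> unfolding D_def by simp
    ultimately show "n \<in> D m \<sigma>" unfolding D_def by blast
  qed
  have H_cong_le: "H k \<tau> \<subseteq> H k \<sigma>" if \<tau>: "\<forall>i<k. \<tau> i = \<sigma> i" for k \<sigma> \<tau>
  proof -
    have "n \<in> D k \<tau> \<and> E n \<tau> = E n \<sigma>" if n: "n \<in> D k \<sigma>" for n
    proof -
      have eq: "E n \<rho> = E n \<sigma>" if "\<forall>i<k. \<rho> i = \<sigma> i" for \<rho>
        using n that unfolding D_def by blast
      have "E n \<rho> = E n \<tau>" if "\<forall>i<k. \<rho> i = \<tau> i" for \<rho>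
        using eq[of \<rho>] eq[OF \<tau>] that \<tau> by metis
      moreover have "n < k" using n unfolding D_def by blast
      ultimately show ?thesis using eq[OF \<tau>] unfolding D_def by blast
    qed
    then show ?thesis unfolding H_def by blast
  qed
  have H_cong: "H k \<tau> = H k \<sigma>" if "\<forall>i<k. \<tau> i = \<sigma> i" for k \<sigma> \<tau>
    using that H_cong_le[of k \<tau> \<sigma>] H_cong_le[of k \<sigma> \<tau>] by (metis subset_antisym)
  have H_antimono: "H m \<sigma> \<subseteq> H k \<sigma>" if "k \<le> m" for k m \<sigma>
    using D_mono[OF that, of \<sigma>] unfolding H_def by blast
  have H_sets: "H k \<sigma> \<in> sets M" for k \<sigma>
  proof (cases "D k \<sigma> = {}")
    case False
    have "D k \<sigma> \<subseteq> {..<k}" unfolding D_def by blast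
    then have "finite (D k \<sigma>)" by (rule finite_subset) simp
    then show ?thesis
      unfolding H_def using False E(2) by (intro sets.Int sets.top sets.finite_INT)
  qed (simp add: H_def)
  have H_sub: "w \<in> E n \<sigma>" if "\<And>k. w \<in> H k \<sigma>" for n w \<sigma>
  proof -
    obtain k where k: "\<And>\<tau>. (\<forall>i<k. \<tau> i = \<sigma> i) \<Longrightarrow> E n \<tau> = E n \<sigma>"
      using E(1)[of n] unfolding locally_constant_def by meson
    have "E n \<tau> = E n \<sigma>" if "\<forall>i<max k (Suc n). \<tau> i = \<sigma> i" for \<tau>
      using that by (intro k) (meson less_max_iff_disj)
    moreover have "n < max k (Suc n)" by simp
    ultimately have "n \<in> D (max k (Suc n)) \<sigma>" unfolding D_def by blast
    then show ?thesis using that[of "max k (Suc n)"] unfolding H_def by blast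
  qed
  have sub_H: "w \<in> H k \<sigma>" if "\<And>n. w \<in> E n \<sigma>" for k w \<sigma>
    using that[of 0] that sets.sets_into_space[OF E(2), of 0 \<sigma>] unfolding H_def by blast
  \<comment> \<open>\<open>T k\<close> contains \<open>S k \<eta>\<close> and is measurable: since
    \<open>H k \<sigma>\<close> depends only on the first \<open>k\<close> coordinates, the union is
    a finite one.\<close>
  define T where "T k = {w. \<exists>\<sigma>. (\<forall>i<k. \<sigma> i \<le> \<eta> i) \<and> w \<in> H k \<sigma>}" for k
  have T_sets: "T k \<in> sets M" for k
  proof -
    have "T k = (\<Union>\<sigma>\<in>PiE {..<k} (\<lambda>i. {..\<eta> i}). H k \<sigma>)"
    proof (intro equalityI subsetI)
      fix w assume "w \<in> T k"
      then obtain \<sigma> where "\<forall>i<k. \<sigma> i \<le> \<eta> i" "w \<in> H k \<sigma>" by (auto simp: T_def)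
      then show "w \<in> (\<Union>\<sigma>\<in>PiE {..<k} (\<lambda>i. {..\<eta> i}). H k \<sigma>)"
        using H_cong[of k "restrict \<sigma> {..<k}" \<sigma>] by (intro UN_I[of "restrict \<sigma> {..<k}"]) auto
    qed (auto simp: T_def PiE_def Pi_def)
    also have "\<dots> \<in> sets M"
      by (intro sets.finite_UN finite_PiE H_sets) auto
    finally show ?thesis .
  qed
  have "T (Suc k) \<subseteq> T k" for k
  proof
    fix w assume "w \<in> T (Suc k)"
    then obtain \<sigma> where "\<forall>i<Suc k. \<sigma> i \<le> \<eta> i" "w \<in> H (Suc k) \<sigma>" unfolding T_def by blast
    moreover have "w \<in> H k \<sigma>" using calculation(2) H_antimono[of k "Suc k" \<sigma>] by auto
    ultimately show "w \<in> T k" unfolding T_def by (intro CollectI exI[of _ \<sigma>]) simp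
  qed
  then have "decseq T" by (rule decseq_SucI)
  have "S k \<eta> \<subseteq> T k" for k
    unfolding S_def T_def using sub_H by blast
  then have "c \<le> emeasure M (T k)" for k
    using S\<eta>[of k] outer_measure_of_mono[of "S k \<eta>" "T k" M] T_sets[of k] by simp
  then have "c \<le> (INF k. emeasure M (T k))" by (intro INF_greatest)
  also have "\<dots> = emeasure M (\<Inter>k. T k)"
    using T_sets \<open>decseq T\<close> by (intro INF_emeasure_decseq) auto
  finally have "c \<le> emeasure M (\<Inter>k. T k)" .
  \<comment> \<open>The witnessing sequences may differ from one \<open>k\<close> to the next. A
    cluster point of them serves all \<open>k\<close> at once, because the sets \<open>H k\<close>
    decrease and see only initial segments.\<close>
  moreover have "(\<Inter>k. T k) \<subseteq> A"
  proof
    fix w assume "w \<in> (\<Inter>k. T k)"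
    then have "\<forall>k. \<exists>\<sigma>. (\<forall>i<k. \<sigma> i \<le> \<eta> i) \<and> w \<in> H k \<sigma>" by (auto simp: T_def)
    then obtain \<sigma> where \<sigma>: "\<And>k i. i < k \<Longrightarrow> \<sigma> k i \<le> \<eta> i" "\<And>k. w \<in> H k (\<sigma> k)" by metis
    obtain l where l: "\<And>k. \<exists>m\<ge>k. \<forall>i<k. \<sigma> m i = l i"
      using bounded_sequences_cluster[of \<sigma> \<eta>] \<sigma>(1) by blast
    have "w \<in> H k l" for k
    proof -
      obtain m where m: "m \<ge> k" "\<forall>i<k. \<sigma> m i = l i" using l by blast
      show ?thesis using \<sigma>(2)[of m] H_antimono[OF m(1)] H_cong[OF m(2)] by blast
    qed
    then have "w \<in> E n l" for n using H_sub by blast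
    then show "w \<in> A" by (auto simp: E(3))
  qed
  ultimately show ?thesis using T_sets by (intro bexI[of _ "\<Inter>k. T k"]) auto
qed

text \<open>The set is squeezed between a measurable hull and a countable union of measurable
  subsets. Inner approximation gives both the same finite measure, so they differ by a null
  set.\<close>

lemma (in finite_measure) souslin_sets_completion:
  assumes A: "A \<in> souslin (sets M)"
  shows "A \<in> sets (completion M)"
proof -
  obtain E0 :: "nat \<Rightarrow> (nat \<Rightarrow> nat) \<Rightarrow> 'a set" where "\<forall>n \<sigma>. E0 n \<sigma> \<in> sets M" "A = (\<Union>\<sigma>. \<Inter>n. E0 n \<sigma>)"
    using A by (rule souslinE)
  then have "A \<subseteq> space M" using sets.sets_into_space by blast
  from outer_measure_of_attain[OF this]
  obtain E where E: "E \<in> sets M" "A \<subseteq> E" "outer_measure_of M A = emeasure M E"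
    by blast
  let ?K = "{K \<in> sets M. K \<subseteq> A}"
  have le: "outer_measure_of M A \<le> Sup (emeasure M ` ?K)"
  proof (rule dense_le)
    fix c assume "c < outer_measure_of M A"
    from souslin_inner_approx[OF A this] obtain K where "K \<in> ?K" "c \<le> emeasure M K" by blast
    then show "c \<le> Sup (emeasure M ` ?K)" by (rule SUP_upper2)
  qed
  have "emeasure M ` ?K \<noteq> {}" by auto
  from ennreal_Sup_countable_SUP[OF this] obtain f
    where f: "range f \<subseteq> emeasure M ` ?K" "Sup (emeasure M ` ?K) = (SUP i::nat. f i)" by auto
  then have "\<forall>i. \<exists>K. K \<in> ?K \<and> f i = emeasure M K" by blast
  from choice[OF this] obtain K where "\<forall>i. K i \<in> ?K \<and> f i = emeasure M (K i)" ..
  then have K: "\<And>i. K i \<in> sets M" "\<And>i. K i \<subseteq> A" "\<And>i. f i = emeasure M (K i)"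
    by simp_all
  let ?U = "\<Union>i. K i"
  have U: "?U \<in> sets M" "?U \<subseteq> A" using K by auto
  have "(SUP i. f i) \<le> emeasure M ?U"
    using K U by (auto intro!: SUP_least emeasure_mono)
  with le f E(3) have "emeasure M E \<le> emeasure M ?U" by simp
  then have "emeasure M (E - ?U) = 0"
    using E U by (subst emeasure_Diff) (auto simp: diff_eq_0_iff_ennreal less_top[symmetric])
  then show ?thesis
    using E U by (intro sets_completionI[of A ?U "A - ?U" "E - ?U"]) auto
qed

text \<open>Even for Borel sets the projection need not be Borel, hence the completion in the
  conclusion.\<close>

theorem (in finite_measure) measurable_projection:
  assumes "A \<in> sets ((borel :: 'b::{complete_space, second_countable_topology} measure) \<Otimes>\<^sub>M M)"
  shows "snd ` A \<in> sets (completion M)"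
  using assms souslin_pair_measure[of M] by (intro souslin_sets_completion souslin_projection) blast

section \<open>Birkhoff sums\<close>

context ergodic_system
begin

section \<open>Iterates of the measure-preserving map\<close>

lemma funpow_T_measurable: "T ^^ n \<in> M \<rightarrow>\<^sub>M M"
proof (induction n)
  case (Suc n)
  show ?case unfolding funpow.simps by (rule measurable_comp[OF Suc T_measurable])
qed simp

lemma distr_T: "distr M M T = M"
proof (rule measure_eqI)
  fix A assume "A \<in> sets (distr M M T)"
  then have "A \<in> sets M" by simp
  then show "emeasure (distr M M T) A = emeasure M A"
    using T_preserving[of A] by (simp add: emeasure_distr T_measurable emeasure_eq_measure)
qed simp

lemma distr_funpow_T: "distr M M (T ^^ n) = M"
proof (induction n)
  case 0
  then show ?case by (simp add: id_def distr_id)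
next
  case (Suc n)
  have "distr M M (T \<circ> T ^^ n) = distr (distr M M (T ^^ n)) M T"
    by (rule distr_distr[symmetric, OF T_measurable funpow_T_measurable])
  then show ?case unfolding funpow.simps Suc distr_T .
qed

lemma AE_orbit:
  assumes "AE w in M. P w"
  shows "AE w in M. \<forall>n. P ((T ^^ n) w)"
proof -
  have "AE w in M. P ((T ^^ n) w)" for n
    by (rule AE_distrD[OF funpow_T_measurable]) (simp only: distr_funpow_T assms)
  then show ?thesis by (simp add: AE_all_countable)
qed

lemma funpow_T_space: "w \<in> space M \<Longrightarrow> (T ^^ n) w \<in> space M"
  using measurable_space[OF funpow_T_measurable] .

lemma
  fixes g :: "'w \<Rightarrow> real"
  assumes "integrable M g"
  shows integrable_T: "integrable M (\<lambda>w. g (T w))"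
    and integral_T: "(\<integral>w. g (T w) \<partial>M) = (\<integral>w. g w \<partial>M)"
  using assms integrable_distr[OF T_measurable, of g] integral_distr[OF T_measurable, of g]
    borel_measurable_integrable[OF assms] by (simp_all add: distr_T)

definition birkhoff_sum :: "('w \<Rightarrow> real) \<Rightarrow> nat \<Rightarrow> 'w \<Rightarrow> real" where
  "birkhoff_sum h n w = (\<Sum>i<n. h ((T ^^ i) w))"

lemma birkhoff_sum_Suc: "birkhoff_sum h (Suc n) w = h w + birkhoff_sum h n (T w)"
  by (simp only: birkhoff_sum_def sum.lessThan_Suc_shift funpow_Suc_right) simp

lemma birkhoff_sum_Suc': "birkhoff_sum h (Suc n) w = birkhoff_sum h n w + h ((T ^^ n) w)"
  by (simp add: birkhoff_sum_def)

lemma birkhoff_sum_measurable [measurable]: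
  "h \<in> borel_measurable M \<Longrightarrow> birkhoff_sum h n \<in> borel_measurable M"
  unfolding birkhoff_sum_def
  by (intro borel_measurable_sum measurable_compose[OF funpow_T_measurable])

text \<open>This is the maximum of the Birkhoff sums of lengths \<open>0\<close> to
  \<open>n\<close>. The recursion splits off the first term, which relates the value at
  \<open>w\<close> directly to the one at \<open>T w\<close>.\<close>

primrec maximal_sum :: "('w \<Rightarrow> real) \<Rightarrow> nat \<Rightarrow> 'w \<Rightarrow> real" where
  "maximal_sum h 0 w = 0"
| "maximal_sum h (Suc n) w = max 0 (h w + maximal_sum h n (T w))"

lemma maximal_sum_nonneg: "0 \<le> maximal_sum h n w"
  by (cases n) auto

lemma maximal_sum_mono_Suc: "maximal_sum h n w \<le> maximal_sum h (Suc n) w"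
proof (induction n arbitrary: w)
  case (Suc n)
  have "max 0 (h w + maximal_sum h n (T w)) \<le> max 0 (h w + maximal_sum h (Suc n) (T w))"
    using Suc[of "T w"] by (intro max.mono add_left_mono order_refl)
  then show ?case by simp
qed simp

lemma maximal_sum_mono: "m \<le> n \<Longrightarrow> maximal_sum h m w \<le> maximal_sum h n w"
  by (rule lift_Suc_mono_le[of "\<lambda>n. maximal_sum h n w"]) (rule maximal_sum_mono_Suc)

lemma birkhoff_sum_le_maximal_sum: "birkhoff_sum h n w \<le> maximal_sum h n w"
proof (induction n arbitrary: w)
  case (Suc n)
  show ?case using Suc[of "T w"] unfolding birkhoff_sum_Suc maximal_sum.simps by linarith
qed (simp add: birkhoff_sum_def)

lemma integrable_maximal_sum:
  assumes "integrable M h"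
  shows "integrable M (maximal_sum h n)"
proof (induction n)
  case (Suc n)
  show ?case using assms integrable_T[OF Suc] by simp
qed simp

text \<open>Boundedness of the sums is an invariant property, so by ergodicity it holds almost
  surely or almost never. The second alternative would make the mean of \<open>h\<close>
  nonnegative, by the maximal ergodic argument.\<close>

lemma birkhoff_sum_bounded:
  assumes h: "integrable M h" and neg: "(\<integral>w. h w \<partial>M) < 0"
  shows "AE w in M. \<exists>K. \<forall>n. birkhoff_sum h n w \<le> K"
proof -
  have [measurable]: "h \<in> borel_measurable M" using h by simp
  \<comment> \<open>Natural numbers as bounds keep this a countable combination of measurable
    sets.\<close>
  define B where "B = {w \<in> space M. \<forall>c::nat. \<exists>n. real c < birkhoff_sum h n w}"
  have B: "B \<in> sets M" unfolding B_def by measurable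
  have B_iff: "w \<in> B \<longleftrightarrow> \<not> (\<exists>K. \<forall>n. birkhoff_sum h n w \<le> K)" if "w \<in> space M" for w
  proof
    assume "w \<in> B"
    then show "\<not> (\<exists>K. \<forall>n. birkhoff_sum h n w \<le> K)"
      unfolding B_def by (smt (verit) mem_Collect_eq real_arch_simple)
  next
    assume "\<not> (\<exists>K. \<forall>n. birkhoff_sum h n w \<le> K)"
    then show "w \<in> B" unfolding B_def using that by (auto simp: not_le)
  qed
  have "(\<exists>K. \<forall>n. birkhoff_sum h n (T w) \<le> K) \<longleftrightarrow> (\<exists>K. \<forall>n. birkhoff_sum h n w \<le> K)" for w
  proof
    assume "\<exists>K. \<forall>n. birkhoff_sum h n (T w) \<le> K"
    then obtain K where K: "\<And>n. birkhoff_sum h n (T w) \<le> K" by blast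
    \<comment> \<open>The \<open>0\<close> takes care of the empty sum.\<close>
    have "birkhoff_sum h n w \<le> max 0 (h w + K)" for n
      using K[of "n - 1"] by (cases n) (auto simp: birkhoff_sum_Suc, simp add: birkhoff_sum_def)
    then show "\<exists>K. \<forall>n. birkhoff_sum h n w \<le> K" by blast
  next
    assume "\<exists>K. \<forall>n. birkhoff_sum h n w \<le> K"
    then obtain K where K: "\<And>n. birkhoff_sum h n w \<le> K" by blast
    have "birkhoff_sum h n (T w) \<le> K - h w" for n
      using K[of "Suc n"] by (simp add: birkhoff_sum_Suc)
    then show "\<exists>K. \<forall>n. birkhoff_sum h n (T w) \<le> K" by blast
  qed
  then have TB: "T w \<in> B \<longleftrightarrow> w \<in> B" if "w \<in> space M" for w
    using B_iff[OF that] B_iff[OF measurable_space[OF T_measurable that]] by metis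
  have "T -` B \<inter> space M = B"
    using TB sets.sets_into_space[OF B] by blast
  with T_ergodic[OF B] consider "prob B = 0" | "prob B = 1" by blast
  then show ?thesis
  proof cases
    case 1
    then have "AE w in M. w \<notin> B"
      using B by (intro AE_not_in null_setsI) (auto simp: emeasure_eq_measure)
    then show ?thesis using B_iff AE_space by fastforce
  next
    case 2
    \<comment> \<open>\<open>d n w = max (h w) (- maximal_sum h n (T w))\<close> has nonnegative mean and equals \<open>h w\<close> for large
      \<open>n\<close>, since the sums are unbounded at \<open>T w\<close>.\<close>
    define d where "d n w = maximal_sum h (Suc n) w - maximal_sum h n (T w)" for n w
    have int: "integrable M (maximal_sum h n)" "integrable M (\<lambda>w. maximal_sum h n (T w))" for n
      using integrable_maximal_sum[OF h] integrable_T by auto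
    \<comment> \<open>Invariance of the measure removes \<open>T\<close> from the second term, and
      what remains is the mean increase of a monotone sequence.\<close>
    have "0 \<le> (\<integral>w. d n w \<partial>M)" for n
    proof -
      have "(\<integral>w. d n w \<partial>M) = (\<integral>w. maximal_sum h (Suc n) w \<partial>M) - (\<integral>w. maximal_sum h n w \<partial>M)"
        unfolding d_def using int(1)[of "Suc n"] int(2)[of n] integral_T[OF int(1)[of n]]
        by (simp del: maximal_sum.simps)
      also have "\<dots> \<ge> 0"
        using integral_mono[OF int(1) int(1) maximal_sum_mono_Suc] by (simp del: maximal_sum.simps)
      finally show ?thesis .
    qed
    moreover have "(\<lambda>n. \<integral>w. d n w \<partial>M) \<longlonglongrightarrow> (\<integral>w. h w \<partial>M)"
    proof (rule integral_dominated_convergence[where w = "\<lambda>w. \<bar>h w\<bar>"])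
      show "d n \<in> borel_measurable M" for n
        unfolding d_def using int by (intro borel_measurable_diff) (auto simp del: maximal_sum.simps)
      have "AE w in M. w \<in> B" using 2 by (rule AE_prob_1)
      then show "AE w in M. (\<lambda>n. d n w) \<longlonglongrightarrow> h w"
      proof (rule AE_mp, intro AE_I2 impI)
        fix w assume w: "w \<in> space M" "w \<in> B"
        then have "T w \<in> B" using TB by simp
        obtain c :: nat where c: "- h w \<le> real c" using real_arch_simple by blast
        obtain m where "real c < birkhoff_sum h m (T w)"
          using \<open>T w \<in> B\<close> unfolding B_def by blast
        then have "- h w \<le> maximal_sum h n (T w)" if "n \<ge> m" for n
          using c birkhoff_sum_le_maximal_sum[of h m "T w"] maximal_sum_mono[OF that, of h "T w"]
          by linarith
        then have "d n w = h w" if "n \<ge> m" for n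
          using that by (force simp: d_def)
        then show "(\<lambda>n. d n w) \<longlonglongrightarrow> h w"
          by (intro tendsto_eventually) (auto simp: eventually_sequentially)
      qed
      \<comment> \<open>Either \<open>d n w\<close> equals \<open>h w\<close> or it lies between
        \<open>h w\<close> and \<open>0\<close>.\<close>
      show "AE w in M. norm (d n w) \<le> \<bar>h w\<bar>" for n
      proof (rule AE_I2)
        show "norm (d n w) \<le> \<bar>h w\<bar>" for w
          using maximal_sum_nonneg[of h n "T w"] unfolding d_def maximal_sum.simps real_norm_def by linarith
      qed
    qed (use h in auto)
    ultimately have "0 \<le> (\<integral>w. h w \<partial>M)" by (intro LIMSEQ_le_const) auto
    with neg show ?thesis by simp
  qed
qed

text \<open>Subtracting \<open>c\<close> makes the mean negative. This one-sided bound takes the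
  place of the full ergodic theorem.\<close>

lemma birkhoff_sum_linear_bound:
  assumes g: "integrable M g" and c: "(\<integral>w. g w \<partial>M) < c"
  shows "AE w in M. \<exists>K. \<forall>n. birkhoff_sum g n w \<le> K + c * real n"
proof -
  have "AE w in M. \<exists>K. \<forall>n. birkhoff_sum (\<lambda>w. g w - c) n w \<le> K"
    using g c by (intro birkhoff_sum_bounded) (auto simp: prob_space)
  moreover have "birkhoff_sum (\<lambda>w. g w - c) n w = birkhoff_sum g n w - c * real n" for n w
    by (simp add: birkhoff_sum_def sum_subtractf)
  ultimately show ?thesis by (simp add: algebra_simps)
qed

lemma integrable_sublinear_along_orbit:
  assumes Y: "integrable M Y" and e: "0 < e"
  shows "AE w in M. \<exists>K. \<forall>n. Y ((T ^^ n) w) \<le> K + e * real n"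
proof -
  \<comment> \<open>\<open>Y (T ^^ n) w\<close> is the difference of two consecutive Birkhoff sums, each close to \<open>n\<close> times the mean.\<close>
  define m where "m = (\<integral>w. Y w \<partial>M)"
  have 1: "AE w in M. \<exists>K. \<forall>n. birkhoff_sum Y n w \<le> K + (m + e / 2) * real n"
    using Y e by (intro birkhoff_sum_linear_bound) (auto simp: m_def)
  have 2: "AE w in M. \<exists>K. \<forall>n. birkhoff_sum (\<lambda>w. - Y w) n w \<le> K + (- m + e / 2) * real n"
    using Y e by (intro birkhoff_sum_linear_bound) (auto simp: m_def)
  from 1 2 show ?thesis
  proof eventually_elim
    case (elim w)
    then obtain K1 K2 where K: "\<And>n. birkhoff_sum Y n w \<le> K1 + (m + e / 2) * real n"
        "\<And>n. birkhoff_sum (\<lambda>w. - Y w) n w \<le> K2 + (- m + e / 2) * real n"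
      by blast
    \<comment> \<open>The constant \<open>m + e / 2\<close> stems from the first sum having
      \<open>Suc n\<close> terms.\<close>
    have "Y ((T ^^ n) w) \<le> (K1 + K2 + m + e / 2) + e * real n" for n
    proof -
      have "birkhoff_sum (\<lambda>w. - Y w) n w = - birkhoff_sum Y n w"
        by (simp add: birkhoff_sum_def sum_negf)
      then show ?thesis
        using K(1)[of "Suc n"] K(2)[of n] by (simp add: birkhoff_sum_Suc' algebra_simps add_divide_distrib)
    qed
    then show ?case by blast
  qed
qed

end

section \<open>Stability\<close>

context stochastic_equilibrium
begin

section \<open>Trajectories near the equilibrium and contraction on average\<close>

lemma trajectory_in_X:
  assumes "w \<in> space M" "a \<in> X w"
  shows "trajectory T f a w n \<in> X ((T ^^ n) w)"
  using assms funpow_T_space[OF assms(1)] f_maps by (induction n) auto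

text \<open>The bound at time \<open>n\<close> and \<open>small\<close> together place the
  trajectory where the Lipschitz estimate applies, which gives the bound at time
  \<open>n + 1\<close>. The argument is deterministic, along one orbit that satisfies the
  equilibrium equation.\<close>

lemma trajectory_contraction:
  assumes lip: "lipschitz_near_equilibrium M f xbar X L \<delta>"
    and w: "w \<in> space M" and eq: "\<And>n. xbar (T ((T ^^ n) w)) = f (xbar ((T ^^ n) w)) ((T ^^ n) w)"
    and a: "a \<in> X w"
    and small: "\<And>n. exp (birkhoff_sum (\<lambda>w. ln (L w)) n w) * dist a (xbar w) \<le> \<delta> ((T ^^ n) w)"
  shows "dist (trajectory T f a w n) (xbar ((T ^^ n) w)) \<le>
    exp (birkhoff_sum (\<lambda>w. ln (L w)) n w) * dist a (xbar w)"
proof (induction n)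
  case (Suc n)
  let ?w = "(T ^^ n) w" and ?x = "trajectory T f a w n"
  have w': "?w \<in> space M" using funpow_T_space[OF w] .
  have L: "0 < L ?w" and lip': "\<And>x. x \<in> near_set xbar X ?w (\<delta> ?w) \<Longrightarrow>
      dist (f x ?w) (f (xbar ?w) ?w) \<le> L ?w * dist x (xbar ?w)"
    using lip w' by (auto simp: lipschitz_near_equilibrium_def positive_random_variable_def)
  have "?x \<in> near_set xbar X ?w (\<delta> ?w)"
    using trajectory_in_X[OF w a] Suc small[of n] by (simp add: near_set_def)
  from lip'[OF this] have "dist (f ?x ?w) (xbar (T ?w)) \<le> L ?w * dist ?x (xbar ?w)"
    by (simp add: eq)
  also have "\<dots> \<le> L ?w * (exp (birkhoff_sum (\<lambda>w. ln (L w)) n w) * dist a (xbar w))"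
    using Suc L by (intro mult_left_mono) auto
  also have "\<dots> = exp (birkhoff_sum (\<lambda>w. ln (L w)) (Suc n) w) * dist a (xbar w)"
    using L by (simp add: birkhoff_sum_Suc' exp_add)
  finally show ?case by simp
qed (simp add: birkhoff_sum_def)

theorem stable_if_contracting_on_average:
  assumes lip: "lipschitz_near_equilibrium M f xbar X L \<delta>"
    and neg: "(\<integral>w. ln (L w) \<partial>M) < 0"
  shows "locally_exponentially_stable M T f xbar X"
proof -
  \<comment> \<open>The mean is \<open>- 3 * l\<close>, strictly below the rate
    \<open>- 2 * l\<close> claimed for the sums. Allowing \<delta> to decay at rate \<open>l\<close>
    then still leaves \<open>l * n\<close> to spare in the exponent.\<close>
  define l where "l = - (\<integral>w. ln (L w) \<partial>M) / 3"
  have l: "l > 0" "(\<integral>w. ln (L w) \<partial>M) < - 2 * l" using neg by (auto simp: l_def)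
  have int: "integrable M (\<lambda>w. ln (L w))" "integrable M (\<lambda>w. ln (\<delta> w))"
    and \<delta>_pos: "\<And>w. w \<in> space M \<Longrightarrow> 0 < \<delta> w"
    and [measurable]: "L \<in> borel_measurable M" "\<delta> \<in> borel_measurable M"
    using lip by (auto simp: lipschitz_near_equilibrium_def positive_random_variable_def)
  define S where "S = birkhoff_sum (\<lambda>w. ln (L w))"
  have [measurable]: "S n \<in> borel_measurable M" for n unfolding S_def by measurable
  \<comment> \<open>The cap at \<open>1\<close> later bounds the initial distance, so that
    \<open>?d t \<le> exp (S t w)\<close>.\<close>
  define \<gamma>0 where "\<gamma>0 w = (INF n. min 1 (\<delta> ((T ^^ n) w) * exp (- S n w)))" for w
  \<comment> \<open>A random radius must be positive everywhere, whereas \<open>\<gamma>0\<close> is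
    shown positive only almost surely; the default \<open>1\<close> fills the gap
    measurably.\<close>
  define \<gamma> where "\<gamma> w = (if \<gamma>0 w > 0 then \<gamma>0 w else 1)" for w
  have [measurable]: "(\<lambda>w. \<delta> ((T ^^ n) w)) \<in> borel_measurable M" for n
    by (rule measurable_compose[OF funpow_T_measurable]) simp
  have "(\<lambda>w. min 1 (\<delta> ((T ^^ n) w) * exp (- S n w))) \<in> borel_measurable M" for n
    by measurable
  then have [measurable]: "\<gamma>0 \<in> borel_measurable M"
    unfolding \<gamma>0_def by (intro borel_measurable_cINF_real) simp_all
  have "\<gamma> \<in> borel_measurable M" unfolding \<gamma>_def by measurable
  then have "positive_random_variable M \<gamma>"
    by (simp add: positive_random_variable_def \<gamma>_def)
  moreover have "AE w in M. \<forall>a\<in>near_set xbar X w (\<gamma> w).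
        limsup (\<lambda>t. ereal (1 / real t) * ext_ln (dist (trajectory T f a w t) (xbar ((T ^^ t) w))))
          \<le> ereal (- 2 * l)"
  proof -
    have "AE w in M. \<exists>K. \<forall>n. S n w \<le> K + (- 2 * l) * real n"
      unfolding S_def using int l by (intro birkhoff_sum_linear_bound)
    moreover have "AE w in M. \<exists>K. \<forall>n. - ln (\<delta> ((T ^^ n) w)) \<le> K + l * real n"
      using int l by (intro integrable_sublinear_along_orbit) auto
    moreover note AE_orbit[OF equilibrium] AE_space
    ultimately show ?thesis
    proof eventually_elim
      case (elim w)
      note eq = elim(3) and w = elim(4)
      from elim(1,2) obtain K1 K2 where K1: "\<And>n. S n w \<le> K1 + (- 2 * l) * real n"
        and K2: "\<And>n. - ln (\<delta> ((T ^^ n) w)) \<le> K2 + l * real n" by blast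
      have lower: "exp (- K1 - K2) \<le> \<delta> ((T ^^ n) w) * exp (- S n w)" for n
      proof -
        have "- K1 - K2 \<le> ln (\<delta> ((T ^^ n) w)) - S n w"
          using K1[of n] K2[of n] mult_nonneg_nonneg[of l "real n"] l(1) by linarith
        then have "exp (- K1 - K2) \<le> exp (ln (\<delta> ((T ^^ n) w)) + - S n w)" by simp
        also have "\<dots> = \<delta> ((T ^^ n) w) * exp (- S n w)"
          unfolding exp_add using \<delta>_pos[OF funpow_T_space[OF w]] by simp
        finally show ?thesis .
      qed
      have "min 1 (exp (- K1 - K2)) \<le> \<gamma>0 w"
        unfolding \<gamma>0_def using min.mono[OF order_refl lower] by (intro cINF_greatest) simp_all
      then have "0 < \<gamma>0 w" by (smt (verit) exp_gt_zero)
      then have \<gamma>: "\<gamma> w = \<gamma>0 w" by (simp add: \<gamma>_def)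
      have bdd: "bdd_below (range (\<lambda>n. min 1 (\<delta> ((T ^^ n) w) * exp (- S n w))))"
        using \<delta>_pos[OF funpow_T_space[OF w]] by (intro bdd_belowI2[of _ 0]) (simp add: less_imp_le)
      have \<gamma>_le: "\<gamma> w \<le> 1" "\<gamma> w \<le> \<delta> ((T ^^ n) w) * exp (- S n w)" for n
        using cINF_lower[OF bdd, of n] by (auto simp: \<gamma> \<gamma>0_def)
      show ?case
      proof
        fix a assume "a \<in> near_set xbar X w (\<gamma> w)"
        then have a: "a \<in> X w" "dist a (xbar w) \<le> \<gamma> w" by (auto simp: near_set_def)
        let ?d = "\<lambda>t. dist (trajectory T f a w t) (xbar ((T ^^ t) w))"
        have d_le: "?d n \<le> exp (S n w) * dist a (xbar w)" for n
          unfolding S_def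
        proof (rule trajectory_contraction[OF lip w _ a(1)])
          show "xbar (T ((T ^^ n) w)) = f (xbar ((T ^^ n) w)) ((T ^^ n) w)" for n using eq by blast
          show "exp (birkhoff_sum (\<lambda>w. ln (L w)) n w) * dist a (xbar w) \<le> \<delta> ((T ^^ n) w)" for n
            using order_trans[OF a(2) \<gamma>_le(2)[of n]] by (simp add: S_def exp_minus field_simps)
        qed
        have "limsup (\<lambda>t. ereal (1 / real t) * ext_ln (?d t)) \<le>
            limsup (\<lambda>t. ereal ((K1 + (- 2 * l) * real t) / real t))"
        proof (rule Limsup_mono)
          show "\<forall>\<^sub>F t in sequentially. ereal (1 / real t) * ext_ln (?d t) \<le>
              ereal ((K1 + (- 2 * l) * real t) / real t)"
            \<comment> \<open>For \<open>t > 0\<close> the factor is positive, so a vanishing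
              distance yields minus infinity rather than \<open>0\<close>.\<close>
            using eventually_gt_at_top[of 0]
          proof eventually_elim
            case (elim t)
            show ?case
            proof (cases "?d t = 0")
              case False
              have "?d t \<le> exp (S t w)"
                using d_le[of t] a(2) \<gamma>_le(1) by (smt (verit) exp_gt_zero mult_left_le)
              also have "\<dots> \<le> exp (K1 + (- 2 * l) * real t)" using K1[of t] by simp
              finally have "ln (?d t) \<le> ln (exp (K1 + (- 2 * l) * real t))"
                using False by (subst ln_le_cancel_iff) simp_all
              then have "ln (?d t) \<le> K1 + (- 2 * l) * real t" by simp
              then show ?thesis using False elim
                by (simp add: ext_ln_def divide_right_mono)
            qed (use elim in \<open>simp add: ext_ln_def\<close>)
          qed
        qed
        also have "\<dots> = ereal (- 2 * l)"
        proof (rule lim_imp_Limsup)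
          have "(\<lambda>t. (K1 + (- 2 * l) * real t) / real t) \<longlonglongrightarrow> - 2 * l" by real_asymp
          then show "(\<lambda>t. ereal ((K1 + (- 2 * l) * real t) / real t)) \<longlonglongrightarrow> ereal (- 2 * l)" by simp
        qed simp
        finally show "limsup (\<lambda>t. ereal (1 / real t) * ext_ln (?d t)) \<le> ereal (- 2 * l)" .
      qed
    qed
  qed
  ultimately show ?thesis
    unfolding locally_exponentially_stable_def using l(1) by (intro exI[of _ \<gamma>] exI[of _ "- 2 * l"]) simp
qed

end

section \<open>Measurable hulls, logarithmic majorants and operator norms\<close>

lemma completion_hull:
  assumes "A \<in> sets (completion M)"
  obtains E where "E \<in> sets M" "A \<subseteq> E" "emeasure M E \<le> emeasure (completion M) A"
proof -
  obtain S N N' where *: "A = S \<union> N" "N \<subseteq> N'" "N' \<in> null_sets M" "S \<in> sets M"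
    using assms by (rule sets_completionE)
  have "emeasure M (S \<union> N') = emeasure M S"
    using * by (intro emeasure_Un_null_set)
  also have "\<dots> = emeasure (completion M) S"
    using *(4) by simp
  also have "\<dots> \<le> emeasure (completion M) A"
    by (rule emeasure_mono[OF _ assms]) (use * in auto)
  finally show ?thesis using * by (intro that[of "S \<union> N'"]) auto
qed

text \<open>Raising \<open>l\<close> to at least \<open>exp (- k)\<close> makes its logarithm
  integrable. By monotone convergence the mean is negative for some \<open>k\<close>, also when the
  original expectation is minus infinity, and a factor slightly above \<open>1\<close> then makes
  the majorant strict.\<close>

lemma (in prob_space) strict_log_majorant:
  assumes l [measurable]: "l \<in> borel_measurable M" and l0: "\<And>w. w \<in> space M \<Longrightarrow> 0 \<le> l w"
    and neg: "ext_expectation M (\<lambda>w. ext_ln (l w)) < 0"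
  obtains \<kappa> where "\<kappa> \<in> borel_measurable M" "\<And>w. w \<in> space M \<Longrightarrow> l w < \<kappa> w"
    "integrable M (\<lambda>w. ln (\<kappa> w))" "(\<integral>w. ln (\<kappa> w) \<partial>M) < 0"
proof -
  \<comment> \<open>\<open>l\<close> is nonnegative on \<open>space M\<close> only; the truncation
    extends this to all points and leaves the expectation unchanged.\<close>
  define a where "a w = max 0 (l w)" for w
  \<comment> \<open>\<open>p\<close> is the positive part of the logarithm, \<open>q k\<close> its negative part truncated at \<open>k\<close>.\<close>
  define p where "p w = ln (max 1 (a w))" for w
  define q where "q k w = (if a w = 0 then real k else min (real k) (max 0 (- ln (a w))))" for k :: nat and w
  have [measurable]: "a \<in> borel_measurable M" "p \<in> borel_measurable M" "q k \<in> borel_measurable M" for k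
    unfolding a_def p_def q_def by measurable
  have a0: "0 \<le> a w" for w by (simp add: a_def)
  have p0: "0 \<le> p w" and q0: "0 \<le> q k w" "q k w \<le> real k" for k w
    by (auto simp: p_def q_def)
  have ln_split: "ln (max (a w) (exp (- real k))) = p w - q k w" for k w
  proof (cases "a w = 0")
    case False
    then have pos: "a w > 0" using a0[of w] by simp
    show ?thesis
    proof (cases "a w \<ge> 1")
      case True
      moreover have "exp (- real k) \<le> 1" by simp
      ultimately have "max (a w) (exp (- real k)) = a w" by linarith
      then show ?thesis using True pos by (simp add: p_def q_def)
    next
      case False
      then have "ln (a w) < 0" using pos by simp
      moreover have "exp (- real k) \<le> a w \<longleftrightarrow> - real k \<le> ln (a w)"
        using pos by (rule ln_ge_iff[symmetric])
      ultimately show ?thesis using False pos by (auto simp: p_def q_def max_def min_def)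
    qed
  qed (simp add: p_def q_def)
  define P where "P = (\<integral>\<^sup>+w. ennreal (p w) \<partial>M)"
  define N where "N = (\<integral>\<^sup>+w. e2ennreal (- ext_ln (a w)) \<partial>M)"
  have "e2ennreal (ext_ln (a w)) = ennreal (p w)" for w
    using a0[of w] by (auto simp: ext_ln_def p_def max_def e2ennreal_neg ennreal_neg)
  then have "ext_expectation M (\<lambda>w. ext_ln (a w)) = enn2ereal P - enn2ereal N"
    by (simp add: ext_expectation_def P_def N_def)
  moreover have "ext_expectation M (\<lambda>w. ext_ln (a w)) = ext_expectation M (\<lambda>w. ext_ln (l w))"
    unfolding ext_expectation_def using l0
    by (intro arg_cong2[where f = "(-)"] arg_cong[where f = enn2ereal] nn_integral_cong) (simp_all add: a_def)
  ultimately have PN: "enn2ereal P - enn2ereal N < 0" using neg by simp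
  \<comment> \<open>Since the difference of two infinities is plus infinity in \<open>ereal\<close>,
    a negative difference also forces \<open>P\<close> to be finite.\<close>
  have "enn2ereal P < enn2ereal N"
    using PN by (cases "enn2ereal P"; cases "enn2ereal N") auto
  then have "P < N" by (simp add: less_ennreal.rep_eq)
  have "(\<lambda>k. \<integral>\<^sup>+w. ennreal (q k w) \<partial>M) \<longlonglongrightarrow> N"
    unfolding N_def
  proof (rule nn_integral_LIMSEQ)
    show "incseq (\<lambda>k w. ennreal (q k w))"
      by (auto simp: incseq_def le_fun_def q_def intro!: ennreal_leI)
    show "(\<lambda>k. ennreal (q k w)) \<longlonglongrightarrow> e2ennreal (- ext_ln (a w))" for w
    proof (cases "a w = 0")
      case True
      then show ?thesis
        using of_nat_tendsto_top_ennreal by (simp add: q_def ext_ln_def ennreal_of_nat_eq_real_of_nat)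
    next
      case False
      obtain m :: nat where m: "max 0 (- ln (a w)) \<le> real m" using real_arch_simple by blast
      have "q k w = max 0 (- ln (a w))" if "k \<ge> m" for k
      proof -
        have "max 0 (- ln (a w)) \<le> real k" using m of_nat_mono[OF that, where 'a = real] by linarith
        then show ?thesis using False unfolding q_def by (simp only: min_absorb2 if_False)
      qed
      then have "\<forall>\<^sub>F k in sequentially. ennreal (q k w) = e2ennreal (- ext_ln (a w))"
        using False by (auto simp: eventually_sequentially ext_ln_def max_def ennreal_neg intro!: exI[of _ m])
      then show ?thesis by (rule tendsto_eventually)
    qed
  qed simp
  from eventually_happens'[OF sequentially_bot order_tendstoD(1)[OF this \<open>P < N\<close>]]
  obtain k where k: "P < (\<integral>\<^sup>+w. ennreal (q k w) \<partial>M)" ..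
  have int_q: "integrable M (q k)"
    using q0 by (intro integrable_const_bound[where B = "real k"]) auto
  have "P < \<infinity>" using k less_le_trans top_greatest by fastforce
  then have int_p: "integrable M p"
    using p0 by (intro integrableI_nonneg) (auto simp: P_def)
  have "ennreal (\<integral>w. p w \<partial>M) < ennreal (\<integral>w. q k w \<partial>M)"
    using k nn_integral_eq_integral[OF int_p] nn_integral_eq_integral[OF int_q] p0 q0
    by (simp add: P_def)
  then have less: "(\<integral>w. p w \<partial>M) < (\<integral>w. q k w \<partial>M)"
    using p0 by (simp add: ennreal_less_iff integral_nonneg_AE)
  \<comment> \<open>Half the gap: the mean of \<open>ln (\<kappa> w)\<close> becomes
    \<open>- e\<close>.\<close>
  define e where "e = ((\<integral>w. q k w \<partial>M) - (\<integral>w. p w \<partial>M)) / 2"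
  have e: "e > 0" using less by (simp add: e_def)
  define \<kappa> where "\<kappa> w = exp e * max (a w) (exp (- real k))" for w
  have pos: "0 < max (a w) (exp (- real k))" for w by (simp add: less_max_iff_disj)
  have ln_\<kappa>: "ln (\<kappa> w) = e + (p w - q k w)" for w
    unfolding \<kappa>_def using pos[of w] by (simp add: ln_mult ln_split)
  show ?thesis
  proof (rule that[of \<kappa>])
    show "\<kappa> \<in> borel_measurable M" unfolding \<kappa>_def by measurable
    show "l w < \<kappa> w" for w
    proof -
      have "l w \<le> max (a w) (exp (- real k))" by (simp add: a_def le_max_iff_disj)
      also have "\<dots> < \<kappa> w" using mult_strict_right_mono[OF iffD2[OF one_less_exp_iff e] pos[of w]] unfolding mult_1 \<kappa>_def .
      finally show ?thesis .
    qed
    show "integrable M (\<lambda>w. ln (\<kappa> w))" unfolding ln_\<kappa> using int_p int_q by simp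
    show "(\<integral>w. ln (\<kappa> w) \<partial>M) < 0" unfolding ln_\<kappa> using int_p int_q less by (simp add: e_def prob_space field_simps)
  qed
qed

text \<open>The points violating the bound form an open set, which would meet \<open>D\<close> if it
  were nonempty. With a countable \<open>D\<close> this reduces measurability of the norm to
  countably many conditions.\<close>

lemma onorm_le_if_dense:
  fixes F :: "'b::real_normed_vector \<Rightarrow> 'c::real_normed_vector"
  assumes F: "bounded_linear F" and D: "\<And>X. open X \<Longrightarrow> X \<noteq> {} \<Longrightarrow> \<exists>d\<in>D. d \<in> X"
    and a: "0 \<le> a" and le: "\<And>x. x \<in> D \<Longrightarrow> norm (F x) \<le> a * norm x"
  shows "onorm F \<le> a"
proof (rule onorm_bound[OF a])
  fix x
  let ?U = "{x. a * norm x < norm (F x)}"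
  have "open ?U"
    by (intro open_Collect_less continuous_intros linear_continuous_on F)
  with D[of ?U] le have "?U = {}" by (force simp: not_less[symmetric])
  then show "norm (F x) \<le> a * norm x" by (auto simp: not_less)
qed

text \<open>The remainder estimate is applied along the vectors \<open>h / (n + 1)\<close>. This
  makes the derivative in a fixed direction a pointwise limit of difference quotients, whence its
  measurability in \<open>w\<close>.\<close>

lemma has_derivative_directional_limit:
  assumes "(g has_derivative F) (at x)"
  shows "(\<lambda>n. real (Suc n) *\<^sub>R (g (x + (1 / real (Suc n)) *\<^sub>R h) - g x)) \<longlonglongrightarrow> F h"
proof (cases "h = 0")
  case False
  have bl: "bounded_linear F" and lim: "(\<lambda>h. norm (g (x + h) - g x - F h) / norm h) \<midarrow>0\<rightarrow> 0"
    using assms by (simp_all add: has_derivative_at)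
  interpret F: bounded_linear F by fact
  define r where "r n = (1 / real (Suc n)) *\<^sub>R h" for n
  have "(\<lambda>n. 1 / real (Suc n)) \<longlonglongrightarrow> 0" by real_asymp
  then have "r \<longlonglongrightarrow> 0 *\<^sub>R h" unfolding r_def by (intro tendsto_intros)
  then have "filterlim r (at 0) sequentially"
    using False by (simp add: filterlim_at r_def)
  from filterlim_compose[OF lim this]
  have "(\<lambda>n. norm (g (x + r n) - g x - F (r n)) / norm (r n) * norm h) \<longlonglongrightarrow> 0 * norm h"
    by (intro tendsto_mult_right)
  moreover have "norm (g (x + r n) - g x - F (r n)) / norm (r n) * norm h =
      norm (real (Suc n) *\<^sub>R (g (x + r n) - g x) - F h)" for n
  proof -
    have "real (Suc n) *\<^sub>R F (r n) = F h" by (simp add: r_def F.scaleR)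
    then have "real (Suc n) *\<^sub>R (g (x + r n) - g x) - F h = real (Suc n) *\<^sub>R (g (x + r n) - g x - F (r n))"
      by (metis scaleR_diff_right)
    then have "norm (real (Suc n) *\<^sub>R (g (x + r n) - g x) - F h) =
        real (Suc n) * norm (g (x + r n) - g x - F (r n))"
      by simp
    moreover have "norm (r n) = norm h / real (Suc n)" by (simp add: r_def)
    ultimately show ?thesis using False by simp
  qed
  ultimately have "(\<lambda>n. norm (real (Suc n) *\<^sub>R (g (x + r n) - g x) - F h)) \<longlonglongrightarrow> 0"
    by simp
  then show ?thesis unfolding r_def tendsto_norm_zero_iff by (rule LIM_zero_cancel)
next
  case True
  have "F 0 = 0"
    using assms by (intro linear_0 bounded_linear.linear has_derivative_bounded_linear)
  then show ?thesis using True by simp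
qed

section \<open>Measurable radii and the differentiable case\<close>

lemma integrable_ln_min:
  fixes \<delta> :: "'w \<Rightarrow> real"
  assumes "finite_measure M" "integrable M (\<lambda>w. ln (\<delta> w))" "\<delta> \<in> borel_measurable M" "c > 0"
  shows "integrable M (\<lambda>w. ln (min (\<delta> w) c))"
proof -
  interpret finite_measure M by fact
  show ?thesis
  proof (rule Bochner_Integration.integrable_bound)
    show "integrable M (\<lambda>w. \<bar>ln (\<delta> w)\<bar> + \<bar>ln c\<bar>)" using assms by simp
    show "(\<lambda>w. ln (min (\<delta> w) c)) \<in> borel_measurable M" using assms(3) by measurable
  qed (auto simp: min_def)
qed

text \<open>\<open>L\<close> need not contract on average. It is kept only on sets decreasing to a
  null set, where integrability of \<open>ln L\<close> makes its contribution vanish. The statement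
  is placed outside the locale so that the type can carry the completeness and countability required
  for projecting.\<close>

theorem stable_if_pointwise_contraction:
  fixes f :: "'a::{complete_space, second_countable_topology} \<Rightarrow> 'w \<Rightarrow> 'a"
  assumes se: "stochastic_equilibrium M T f xbar X"
    and lip: "lipschitz_near_equilibrium M f xbar X L \<delta>"
    and \<kappa>: "positive_random_variable M \<kappa>"
    and int_\<kappa>: "integrable M (\<lambda>w. ln (\<kappa> w))" and neg: "(\<integral>w. ln (\<kappa> w) \<partial>M) < 0"
    and contr: "\<And>w. w \<in> space M \<Longrightarrow>
      \<exists>r>0. \<forall>x. dist x (xbar w) < r \<longrightarrow> dist (f x w) (f (xbar w) w) \<le> \<kappa> w * dist x (xbar w)"
  shows "locally_exponentially_stable M T f xbar X"
proof -
  interpret stochastic_equilibrium M T f xbar X by fact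
  interpret completion: finite_measure "completion M"
    by (rule finite_measureI) (simp add: emeasure_eq_measure)
  have [measurable]: "\<kappa> \<in> borel_measurable M" and \<kappa>_pos: "\<And>w. w \<in> space M \<Longrightarrow> 0 < \<kappa> w"
    using \<kappa> by (auto simp: positive_random_variable_def)
  have [measurable]: "L \<in> borel_measurable M" "\<delta> \<in> borel_measurable M"
    and L_pos: "\<And>w. w \<in> space M \<Longrightarrow> 0 < L w" and \<delta>_pos: "\<And>w. w \<in> space M \<Longrightarrow> 0 < \<delta> w"
    and int_L: "integrable M (\<lambda>w. ln (L w))" and int_\<delta>: "integrable M (\<lambda>w. ln (\<delta> w))"
    and L: "\<And>w x. w \<in> space M \<Longrightarrow> x \<in> near_set xbar X w (\<delta> w) \<Longrightarrow>
      dist (f x w) (f (xbar w) w) \<le> L w * dist x (xbar w)"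
    using lip by (auto simp: lipschitz_near_equilibrium_def positive_random_variable_def)
  note [measurable] = xbar_measurable
  have f_meas: "(\<lambda>p. f (fst p) (snd p)) \<in> borel \<Otimes>\<^sub>M M \<rightarrow>\<^sub>M borel"
    using f_measurable by (simp add: case_prod_beta')
  have "(\<lambda>p. (xbar (snd p), snd p)) \<in> (borel :: 'a measure) \<Otimes>\<^sub>M M \<rightarrow>\<^sub>M borel \<Otimes>\<^sub>M M"
    by measurable
  from measurable_compose[OF this f_meas]
  have f_xbar_meas: "(\<lambda>p. f (xbar (snd p)) (snd p)) \<in> (borel :: 'a measure) \<Otimes>\<^sub>M M \<rightarrow>\<^sub>M borel"
    by simp
  note [measurable] = f_meas f_xbar_meas
  \<comment> \<open>The projection of \<open>A n\<close> consists of the \<open>w\<close> at which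
    the radius \<open>1 / (n + 1)\<close> is too large for contraction by
    \<open>\<kappa> w\<close>.\<close>
  define A where "A n = {p \<in> space (borel \<Otimes>\<^sub>M M).
      \<kappa> (snd p) * dist (fst p) (xbar (snd p)) < dist (f (fst p) (snd p)) (f (xbar (snd p)) (snd p)) \<and>
      dist (fst p) (xbar (snd p)) \<le> 1 / real (Suc n)}" for n
  have "A n \<in> sets (borel \<Otimes>\<^sub>M M)" for n unfolding A_def by measurable
  then have C_sets: "snd ` A n \<in> sets (completion M)" for n by (rule measurable_projection)
  have "A (Suc n) \<subseteq> A n" for n
  proof -
    have "1 / real (Suc (Suc n)) \<le> 1 / real (Suc n)" by (simp add: field_simps)
    then show ?thesis unfolding A_def by auto
  qed
  then have "decseq (\<lambda>n. snd ` A n)" by (intro decseq_SucI image_mono)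
  moreover have "(\<Inter>n. snd ` A n) = {}"
  proof (rule equals0I)
    fix w assume w: "w \<in> (\<Inter>n. snd ` A n)"
    then have "w \<in> space M" by (auto simp: A_def space_pair_measure)
    then obtain r where r: "r > 0" "\<And>x. dist x (xbar w) < r \<Longrightarrow>
        dist (f x w) (f (xbar w) w) \<le> \<kappa> w * dist x (xbar w)"
      using contr by blast
    obtain n where n: "1 / real (Suc n) < r" using nat_approx_posE[OF r(1)] by blast
    from w obtain p where "p \<in> A n" "snd p = w" by blast
    then show False using r(2)[of "fst p"] n by (auto simp: A_def)
  qed
  ultimately have lim0: "(\<lambda>n. emeasure (completion M) (snd ` A n)) \<longlonglongrightarrow> 0"
    using Lim_emeasure_decseq[of "\<lambda>n. snd ` A n" "completion M"] C_sets completion.emeasure_finite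
    by auto
  have "\<forall>n. \<exists>E. E \<in> sets M \<and> snd ` A n \<subseteq> E \<and> emeasure M E \<le> emeasure (completion M) (snd ` A n)"
    using completion_hull[OF C_sets] by metis
  then obtain E where E: "\<And>n. E n \<in> sets M" "\<And>n. snd ` A n \<subseteq> E n"
      "\<And>n. emeasure M (E n) \<le> emeasure (completion M) (snd ` A n)"
    by metis
  \<comment> \<open>The hulls \<open>E n\<close> need not decrease; their finite intersections do,
    and still contain the decreasing projections.\<close>
  define H where "H n = (\<Inter>m\<in>{..n}. E m)" for n
  have H_sets [measurable]: "H n \<in> sets M" for n unfolding H_def using E(1) by auto
  have A_H: "snd ` A n \<subseteq> H n" for n
    using E(2) \<open>decseq (\<lambda>n. snd ` A n)\<close> unfolding H_def decseq_def by blast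
  have "emeasure M (\<Inter>n. H n) \<le> emeasure (completion M) (snd ` A n)" for n
  proof -
    have "emeasure M (\<Inter>n. H n) \<le> emeasure M (E n)"
      using E(1) by (intro emeasure_mono) (auto simp: H_def)
    then show ?thesis using E(3) order_trans by blast
  qed
  then have "emeasure M (\<Inter>n. H n) \<le> 0"
    using lim0 by (intro LIMSEQ_le_const) auto
  then have null: "(\<Inter>n. H n) \<in> null_sets M" by (intro null_setsI) auto
  define K where "K n w = (if w \<in> H n then L w else \<kappa> w)" for n w
  have [measurable]: "K n \<in> borel_measurable M" for n unfolding K_def by measurable
  have bound: "norm (ln (K n w)) \<le> \<bar>ln (L w)\<bar> + \<bar>ln (\<kappa> w)\<bar>" for n w by (simp add: K_def)
  have int_bound: "integrable M (\<lambda>w. \<bar>ln (L w)\<bar> + \<bar>ln (\<kappa> w)\<bar>)"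
    using int_L int_\<kappa> by simp
  have int_K: "integrable M (\<lambda>w. ln (K n w))" for n
    using int_bound bound by (intro Bochner_Integration.integrable_bound[OF int_bound] AE_I2) auto
  have "(\<lambda>n. \<integral>w. ln (K n w) \<partial>M) \<longlonglongrightarrow> (\<integral>w. ln (\<kappa> w) \<partial>M)"
  proof (rule integral_dominated_convergence[OF _ _ int_bound])
    show "AE w in M. (\<lambda>n. ln (K n w)) \<longlonglongrightarrow> ln (\<kappa> w)"
      using AE_not_in[OF null]
    proof eventually_elim
      case (elim w)
      then obtain m where "w \<notin> H m" by blast
      then have "w \<notin> H n" if "n \<ge> m" for n using that unfolding H_def by force
      then show ?case
        by (intro tendsto_eventually) (auto simp: K_def eventually_sequentially)
    qed
  qed (use bound in auto)
  from eventually_happens'[OF sequentially_bot order_tendstoD(2)[OF this neg]]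
  obtain n where n: "(\<integral>w. ln (K n w) \<partial>M) < 0" ..
  define \<rho> where "\<rho> w = min (\<delta> w) (1 / real (Suc n))" for w
  have "lipschitz_near_equilibrium M f xbar X (K n) \<rho>"
    unfolding lipschitz_near_equilibrium_def
  proof (intro conjI ballI)
    show "positive_random_variable M (K n)"
      using L_pos \<kappa>_pos by (auto simp: positive_random_variable_def K_def)
    have "\<rho> \<in> borel_measurable M" unfolding \<rho>_def by measurable
    then show "positive_random_variable M \<rho>"
      using \<delta>_pos by (auto simp: positive_random_variable_def \<rho>_def)
    show "integrable M (\<lambda>w. ln (\<rho> w))"
      unfolding \<rho>_def using int_\<delta> by (intro integrable_ln_min finite_measure_axioms) auto
    fix w x assume w: "w \<in> space M" and x: "x \<in> near_set xbar X w (\<rho> w)"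
    have x': "x \<in> near_set xbar X w (\<delta> w)" "dist x (xbar w) \<le> 1 / real (Suc n)"
      using x by (auto simp: near_set_def \<rho>_def)
    show "dist (f x w) (f (xbar w) w) \<le> K n w * dist x (xbar w)"
    proof (cases "w \<in> H n")
      case True
      then show ?thesis using L[OF w x'(1)] by (simp add: K_def)
    next
      case False
      then have "(x, w) \<notin> A n" using A_H[of n] by force
      then show ?thesis using False x'(2) w by (simp add: A_def K_def space_pair_measure not_less)
    qed
  qed (rule int_K)
  then show ?thesis using n by (rule stable_if_contracting_on_average)
qed

text \<open>A strict majorant \<kappa> of the operator norm leaves the margin
  \<open>\<kappa> w - onorm (F w)\<close>, which absorbs the remainder of the derivative near
  \<open>xbar w\<close>. Measurability of the norm has to be established first.\<close>

theorem stable_if_derivative_contracting_on_average: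
  fixes f :: "'b::{banach, second_countable_topology} \<Rightarrow> 'w \<Rightarrow> 'b"
  assumes se: "stochastic_equilibrium M T f xbar X"
    and lip: "lipschitz_near_equilibrium M f xbar X L \<delta>"
    and diff: "\<And>w. w \<in> space M \<Longrightarrow> (\<lambda>x. f x w) differentiable (at (xbar w))"
    and neg: "ext_expectation M (\<lambda>w. ext_ln (onorm (frechet_derivative (\<lambda>x. f x w) (at (xbar w))))) < 0"
  shows "locally_exponentially_stable M T f xbar X"
proof -
  interpret stochastic_equilibrium M T f xbar X by fact
  define F where "F w = frechet_derivative (\<lambda>x. f x w) (at (xbar w))" for w
  have F: "((\<lambda>x. f x w) has_derivative F w) (at (xbar w))" if "w \<in> space M" for w
    using diff[OF that] unfolding F_def by (simp add: frechet_derivative_works)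
  have bl: "bounded_linear (F w)" if "w \<in> space M" for w
    using F[OF that] by (rule has_derivative_bounded_linear)
  note [measurable] = xbar_measurable
  have f_meas: "(\<lambda>p. f (fst p) (snd p)) \<in> borel \<Otimes>\<^sub>M M \<rightarrow>\<^sub>M borel"
    using f_measurable by (simp add: case_prod_beta')
  have f_shift: "(\<lambda>w. f (xbar w + h) w) \<in> borel_measurable M" for h
  proof -
    have "(\<lambda>w. (xbar w + h, w)) \<in> M \<rightarrow>\<^sub>M borel \<Otimes>\<^sub>M M" by measurable
    from measurable_compose[OF this f_meas] show ?thesis by simp
  qed
  have F_meas: "(\<lambda>w. F w h) \<in> borel_measurable M" for h
  proof (rule borel_measurable_LIMSEQ_metric)
    fix w assume "w \<in> space M"
    \<comment> \<open>The subtracted term is written with \<open>+ 0\<close> so that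
      \<open>f_shift\<close> gives the measurability of both terms.\<close>
    from has_derivative_directional_limit[OF F[OF this], of h]
    show "(\<lambda>n. real (Suc n) *\<^sub>R (f (xbar w + (1 / real (Suc n)) *\<^sub>R h) w - f (xbar w + 0) w)) \<longlonglongrightarrow> F w h"
      by simp
  qed (intro borel_measurable_scaleR borel_measurable_diff f_shift borel_measurable_const)
  obtain D :: "'b set" where D: "countable D" "\<And>X. open X \<Longrightarrow> X \<noteq> {} \<Longrightarrow> \<exists>d\<in>D. d \<in> X"
    by (rule countable_dense_setE) blast
  have onorm_meas: "(\<lambda>w. onorm (F w)) \<in> borel_measurable M"
    unfolding borel_measurable_iff_le
  proof
    fix a :: real
    show "{w \<in> space M. onorm (F w) \<le> a} \<in> sets M"
    \<comment> \<open>The test on \<open>D\<close> is valid for nonnegative \<open>a\<close> only: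
      on the zero space it holds for every \<open>a\<close>.\<close>
    proof (cases "a < 0")
      case True
      then have "{w \<in> space M. onorm (F w) \<le> a} = {}"
        using onorm_pos_le[OF bl] by force
      then show ?thesis by (simp only: sets.empty_sets)
    next
      case False
      have "onorm (F w) \<le> a \<longleftrightarrow> (\<forall>x\<in>D. norm (F w x) \<le> a * norm x)" if "w \<in> space M" for w
      proof
        assume "onorm (F w) \<le> a"
        then show "\<forall>x\<in>D. norm (F w x) \<le> a * norm x"
          using onorm[OF bl[OF that]] by (meson mult_right_mono norm_ge_zero order_trans)
      next
        assume "\<forall>x\<in>D. norm (F w x) \<le> a * norm x"
        then show "onorm (F w) \<le> a"
          using False by (intro onorm_le_if_dense[OF bl[OF that] D(2)]) auto
      qed
      then have "{w \<in> space M. onorm (F w) \<le> a} = {w \<in> space M. \<forall>x\<in>D. norm (F w x) \<le> a * norm x}"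
        by blast
      also have "\<dots> \<in> sets M"
      proof (rule sets.sets_Collect_countable_All'[OF _ D(1)])
        show "{w \<in> space M. norm (F w x) \<le> a * norm x} \<in> sets M" for x
          using F_meas[of x] by measurable
      qed
      finally show ?thesis .
    qed
  qed
  obtain \<kappa> where \<kappa>: "\<kappa> \<in> borel_measurable M" "\<And>w. w \<in> space M \<Longrightarrow> onorm (F w) < \<kappa> w"
    "integrable M (\<lambda>w. ln (\<kappa> w))" "(\<integral>w. ln (\<kappa> w) \<partial>M) < 0"
    using strict_log_majorant[OF onorm_meas onorm_pos_le[OF bl]] neg unfolding F_def by blast
  show ?thesis
  proof (rule stable_if_pointwise_contraction[OF se lip _ \<kappa>(3,4)])
    show "positive_random_variable M \<kappa>"
      using \<kappa>(1,2) onorm_pos_le[OF bl] by (force simp: positive_random_variable_def)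
    fix w assume w: "w \<in> space M"
    have "\<kappa> w - onorm (F w) > 0" using \<kappa>(2)[OF w] by simp
    then obtain r where r: "r > 0" "\<And>x. norm (x - xbar w) < r \<Longrightarrow>
        norm (f x w - f (xbar w) w - F w (x - xbar w)) \<le> (\<kappa> w - onorm (F w)) * norm (x - xbar w)"
      using F[OF w] unfolding has_derivative_at_alt by blast
    have "dist (f x w) (f (xbar w) w) \<le> \<kappa> w * dist x (xbar w)" if "dist x (xbar w) < r" for x
    proof -
      have "norm (f x w - f (xbar w) w) \<le>
          norm (f x w - f (xbar w) w - F w (x - xbar w)) + norm (F w (x - xbar w))"
        by norm
      also have "\<dots> \<le> (\<kappa> w - onorm (F w)) * norm (x - xbar w) + onorm (F w) * norm (x - xbar w)"
        using r(2)[of x] that onorm[OF bl[OF w]] by (intro add_mono) (auto simp: dist_norm)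
      finally show ?thesis by (simp add: dist_norm algebra_simps)
    qed
    then show "\<exists>r>0. \<forall>x. dist x (xbar w) < r \<longrightarrow>
        dist (f x w) (f (xbar w) w) \<le> \<kappa> w * dist x (xbar w)"
      using r(1) by blast
  qed
qed

text \<open>The alternative hypotheses live on different classes of spaces, so "at least one of (A)
  and (B)" becomes a conjunction of two implications over separate types. For metric spaces
  separability is the same as second countability.\<close>

theorem theorem1:
  fixes M :: "'w measure" and T :: "'w \<Rightarrow> 'w"
  assumes "ergodic_system M T"
  shows
    "(\<forall>(f :: 'a::polish_space \<Rightarrow> 'w \<Rightarrow> 'a) xbar X.
        stochastic_equilibrium M T f xbar X \<longrightarrow>
        (\<exists>L \<delta>. lipschitz_near_equilibrium M f xbar X L \<delta> \<and>
                integral\<^sup>L M (\<lambda>w. ln (L w)) < 0) \<longrightarrow>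
        locally_exponentially_stable M T f xbar X) \<and>
     (\<forall>(f :: 'b::{banach, second_countable_topology} \<Rightarrow> 'w \<Rightarrow> 'b) xbar X.
        stochastic_equilibrium M T f xbar X \<longrightarrow>
        (\<exists>L \<delta>. lipschitz_near_equilibrium M f xbar X L \<delta>) \<longrightarrow>
        (\<forall>w\<in>space M. (\<lambda>x. f x w) differentiable (at (xbar w))) \<longrightarrow>
        ext_expectation M
          (\<lambda>w. ext_ln (onorm (frechet_derivative (\<lambda>x. f x w) (at (xbar w))))) < 0 \<longrightarrow>
        locally_exponentially_stable M T f xbar X)"
  using stochastic_equilibrium.stable_if_contracting_on_average
    stable_if_derivative_contracting_on_average
  by blast

end
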